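(* Let $n,m\ge 1$, let $D\subset\mathbb{R}^n$ be a domain, let $f:D\to\mathbb{R}^m$ be a smooth map, and let $\Sigma=\{(x,f(x)):x\in D\}\subset\mathbb{R}^{n+m}$ be the graph of $f$. Let $c=1$ if $m\le 2$ or $n\le 2$, and $c=\min(m-1,n-1)$ in all other cases. If $\Sigma$ is a minimal submanifold of $\mathbb{R}^{n+m}$ and $$\|df\|\le \frac{\sqrt{1+c}-1}{\sqrt{c}}$$ at every point of $D$, then $\Sigma$ is stable.
   Context: The norm of the differential at a point is $\|df\|=\sup_{|V|=1}|df(V)|$ (operator norm with respect to the Euclidean norms on $\mathbb{R}^n$ and $\mathbb{R}^m$). A minimal submanifold $\Sigma\subset\mathbb{R}^{n+m}$ (mean curvature vector zero) is called stable if the second derivative of the volume functional with respect to any compactly supported normal variation field is nonnegative. Equivalently, for every compactly supported normal vector field $V$ on $\Sigma$, $$\int_\Sigma \|\nabla^N V\|^2\,dv\ \ge\ \int_\Sigma B(V,V)\,dv ,$$ where $dv$ is the induced volume form, $\nabla^N V$ is the covariant derivative of $V$ as a section of the normal bundle, and, in local coordinates $\{x^i\}$ on $\Sigma$ with position vector $F$ and induced metric $g_{ij}$, $$B(V,V)=\sum_{i,j,k,l} g^{ik}g^{jl}\Big\langle \frac{\partial^2F}{\partial x^i\partial x^j},V\Big\rangle\Big\langle \frac{\partial^2F}{\partial x^k\partial x^l},V\Big\rangle .$$ *)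

theory Defs
  imports "HOL-Analysis.Analysis"
begin

fun Ck_on :: "nat \<Rightarrow> 'a::real_normed_vector set \<Rightarrow> ('a \<Rightarrow> 'b::real_normed_vector) \<Rightarrow> bool" where
  "Ck_on 0 S f \<longleftrightarrow> continuous_on S f"
| "Ck_on (Suc k) S f \<longleftrightarrow>
     (\<forall>x\<in>S. f differentiable (at x)) \<and> (\<forall>v. Ck_on k S (\<lambda>x. frechet_derivative f (at x) v))"

text \<open>Only used on open sets, since the derivatives are two-sided.\<close>

definition smooth_on :: "'a::real_normed_vector set \<Rightarrow> ('a \<Rightarrow> 'b::real_normed_vector) \<Rightarrow> bool" where
  "smooth_on S f \<longleftrightarrow> (\<forall>k. Ck_on k S f)"

text \<open>
  Submanifolds are given by a global parametrization \<open>F\<close> on an open set \<open>D\<close> of \<open>\<real>\<^sup>n\<close>,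
  with values in a Euclidean space.
\<close>

definition partial_d :: "'n::finite \<Rightarrow> (real^'n \<Rightarrow> 'a::euclidean_space) \<Rightarrow> real^'n \<Rightarrow> 'a" where
  "partial_d i F x = frechet_derivative F (at x) (axis i 1)"

definition induced_metric :: "(real^'n \<Rightarrow> 'a::euclidean_space) \<Rightarrow> real^'n \<Rightarrow> real^'n^'n" where
  "induced_metric F x = (\<chi> i j. partial_d i F x \<bullet> partial_d j F x)"

definition normal_space :: "(real^'n \<Rightarrow> 'a::euclidean_space) \<Rightarrow> real^'n \<Rightarrow> 'a set" where
  "normal_space F x = {v. \<forall>i. v \<bullet> partial_d i F x = 0}"

definition normal_part :: "(real^'n \<Rightarrow> 'a::euclidean_space) \<Rightarrow> real^'n \<Rightarrow> 'a \<Rightarrow> 'a" where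
  "normal_part F x v =
     v - (\<Sum>i\<in>UNIV. \<Sum>j\<in>UNIV.
           (matrix_inv (induced_metric F x) $ i $ j * (v \<bullet> partial_d i F x)) *\<^sub>R partial_d j F x)"

definition second_fundamental_form ::
  "(real^'n \<Rightarrow> 'a::euclidean_space) \<Rightarrow> real^'n \<Rightarrow> 'n \<Rightarrow> 'n \<Rightarrow> 'a" where
  "second_fundamental_form F x i j = normal_part F x (partial_d i (partial_d j F) x)"

definition mean_curvature :: "(real^'n \<Rightarrow> 'a::euclidean_space) \<Rightarrow> real^'n \<Rightarrow> 'a" where
  "mean_curvature F x =
     (\<Sum>i\<in>UNIV. \<Sum>j\<in>UNIV.
        matrix_inv (induced_metric F x) $ i $ j *\<^sub>R second_fundamental_form F x i j)"

definition minimal_on :: "(real^'n) set \<Rightarrow> (real^'n \<Rightarrow> 'a::euclidean_space) \<Rightarrow> bool" where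
  "minimal_on D F \<longleftrightarrow> (\<forall>x\<in>D. mean_curvature F x = 0)"

definition volume :: "(real^'n) set \<Rightarrow> (real^'n \<Rightarrow> 'a::euclidean_space) \<Rightarrow> real" where
  "volume K F = integral K (\<lambda>x. sqrt (det (induced_metric F x)))"

text \<open>
  \<open>\<Phi>\<close> is an arbitrary smooth variation, not necessarily of the form \<open>F + t V\<close>, that is fixed
  outside the compact set \<open>K\<close>; its variation field at time \<open>0\<close> is a normal field.
\<close>

definition normal_variation ::
  "(real^'n) set \<Rightarrow> (real^'n \<Rightarrow> 'a::euclidean_space) \<Rightarrow> (real^'n) set
    \<Rightarrow> (real \<Rightarrow> real^'n \<Rightarrow> 'a) \<Rightarrow> bool" where
  "normal_variation D F K \<Phi> \<longleftrightarrow>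
     compact K \<and> K \<subseteq> D \<and>
     (\<exists>\<epsilon>>0. smooth_on ({-\<epsilon><..<\<epsilon>} \<times> D) (\<lambda>(t, x). \<Phi> t x) \<and>
            (\<forall>t\<in>{-\<epsilon><..<\<epsilon>}. \<forall>x\<in>D - K. \<Phi> t x = F x)) \<and>
     (\<forall>x\<in>D. \<Phi> 0 x = F x) \<and>
     (\<forall>x\<in>D. vector_derivative (\<lambda>t. \<Phi> t x) (at 0) \<in> normal_space F x)"

text \<open>
  The volume of the whole submanifold may be infinite, so only the part over \<open>K\<close>, outside of
  which nothing moves, is measured. For an immersion \<open>F\<close> it is a smooth function of \<open>t\<close> near \<open>0\<close>.
\<close>

definition stable_on :: "(real^'n) set \<Rightarrow> (real^'n \<Rightarrow> 'a::euclidean_space) \<Rightarrow> bool" where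
  "stable_on D F \<longleftrightarrow>
     (\<forall>K \<Phi>. normal_variation D F K \<Phi> \<longrightarrow> deriv (deriv (\<lambda>t. volume K (\<Phi> t))) 0 \<ge> 0)"

definition graph_param :: "('a \<Rightarrow> 'b) \<Rightarrow> 'a \<Rightarrow> 'a \<times> 'b" where
  "graph_param f x = (x, f x)"

end

theory Submission
  imports Defs
begin

text \<open>
  The bound on \<open>df\<close> is always smaller than \<open>1\<close>. The area integrand
  \<open>A P = sqrt (det (1 + P\<^sup>T P))\<close> is convex (even logarithmically convex) on the ball of matrices of
  operator norm at most \<open>1\<close>. A variation \<open>(X\<^sub>t, Y\<^sub>t)\<close> of the graph is, for small \<open>t\<close>, the graph of
  \<open>h = Y\<^sub>t \<circ> X\<^sub>t\<^sup>-\<^sup>1\<close> up to a reparametrization, with operator norm of \<open>dh\<close> still at most \<open>1\<close>. Hence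
  its volume is at least the integral of \<open>A (df) + DA (df) (dh - df)\<close>, and the second term integrates
  to \<open>0\<close> by the minimal surface system, since \<open>h - f\<close> has compact support. So the volume has a local
  minimum at \<open>t = 0\<close>.
\<close>

subsection \<open>Determinants and inverses\<close>

text \<open>Stability is obtained without a second variation formula: a local minimum of the volume
  already fixes the sign of the second derivative, for arbitrary smooth variations. The radius 1
  comes from the matrix \<open>P (1 + P^T P)^-1 P^T\<close>. Its eigenvalues are
  \<open>\<sigma>^2 / (1 + \<sigma>^2)\<close> or 0, with \<sigma> a singular value of
  \<open>P\<close>, hence at most 1/2 when \<open>P\<close> does not increase lengths; the Hessian
  of the logarithm of the integrand meets this matrix with a factor 2. The hypothesis supplies one
  constant \<beta> < 1 on all of \<open>D\<close>, and the gap \<open>1 - \<beta>\<close> pays for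
  moving both components of the graph. Three obstacles shape the rest. \<open>K\<close> is any
  compact set, with no boundary to integrate over, so test functions are extended by zero and
  integrated over the whole space. The base point moves as well, so the first component is extended
  to a bijection of the whole space that maps \<open>K\<close> onto itself, and volumes are compared
  after a change of variables. Finally \<open>deriv\<close> is a total function, so minimality bears
  on \<open>deriv (deriv ...)\<close> only once the volume is known to be twice differentiable at
  0.\<close>

lemma inner_transpose_mult:
  fixes M :: "real^'n^'m"
  shows "u \<bullet> (transpose M *v v) = (M *v u) \<bullet> v"
  by (metis dot_lmul_matrix inner_commute transpose_matrix_vector)

lemma matrix_inv_eq:
  fixes A :: "real^'n^'n"
  assumes "invertible A"
  shows matrix_inv_right: "A ** matrix_inv A = mat 1"
    and matrix_inv_left: "matrix_inv A ** A = mat 1"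
proof -
  have "\<exists>B. A ** B = mat 1 \<and> B ** A = mat 1"
    using assms by (auto simp: invertible_def)
  then have "A ** matrix_inv A = mat 1 \<and> matrix_inv A ** A = mat 1"
    unfolding matrix_inv_def by (rule someI_ex)
  then show "A ** matrix_inv A = mat 1" "matrix_inv A ** A = mat 1" by auto
qed

lemma transpose_matrix_inv_symmetric:
  fixes A :: "real^'n^'n"
  assumes "invertible A" and "transpose A = A"
  shows "transpose (matrix_inv A) = matrix_inv A"
proof -
  let ?H = "matrix_inv A"
  have "transpose ?H ** A = mat 1"
    using arg_cong[OF matrix_inv_right[OF assms(1)], of transpose] assms(2)
    by (simp add: matrix_transpose_mul transpose_mat)
  then have "transpose ?H ** A ** ?H = ?H" by simp
  then show ?thesis
    using matrix_inv_right[OF assms(1)] by (simp add: matrix_mul_assoc[symmetric])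
qed

text \<open>Each entry becomes a quotient of polynomials in the entries of \<open>A\<close>;
  differentiability and \<open>Ck_on\<close> regularity of the inverse are read off from this
  form.\<close>

lemma matrix_inv_cramer:
  fixes A :: "real^'n^'n"
  assumes "det A \<noteq> 0"
  shows "matrix_inv A $ i $ j = det (\<chi> p q. if q = i then axis j 1 $ p else A $ p $ q) / det A"
proof -
  have inv: "invertible A" using assms invertible_det_nz by blast
  have "A *v (matrix_inv A *v axis j 1) = axis j 1"
    using matrix_inv_right[OF inv] by (simp add: matrix_vector_mul_assoc)
  then have "matrix_inv A *v axis j 1
      = (\<chi> k. det (\<chi> p q. if q = k then axis j 1 $ p else A $ p $ q) / det A)"
    using cramer[OF assms] by blast
  then have "(matrix_inv A *v axis j 1) $ i
      = det (\<chi> p q. if q = i then axis j 1 $ p else A $ p $ q) / det A"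
    by simp
  then show ?thesis
    by (simp add: matrix_vector_mul_component axis_def inner_axis' inner_vec_def if_distrib cong: if_cong)
qed

lemma matrix_mul_minus_left: "(- A) ** B = - (A ** B)" for A :: "'a::ring_1^'n^'m"
  by (simp add: vec_eq_iff matrix_matrix_mult_def sum_negf)

text \<open>The segment from the identity to \<open>A\<close> stays positive definite, so every
  matrix on it has trivial kernel and the determinant cannot leave the sign it has at the identity.
  Neither symmetry of \<open>A\<close> nor eigenvalues enter.\<close>

lemma det_pos_definite:
  fixes A :: "real^'n^'n"
  assumes pos: "\<And>u. u \<noteq> 0 \<Longrightarrow> u \<bullet> (A *v u) > 0"
  shows "det A > 0"
proof -
  define M where "M s = (1 - s) *\<^sub>R mat 1 + s *\<^sub>R A" for s :: real
  have nz: "det (M s) \<noteq> 0" if "0 \<le> s" "s \<le> 1" for s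
  proof -
    have "u = 0" if "M s *v u = 0" for u
    proof (rule ccontr)
      assume u: "u \<noteq> 0"
      have "u \<bullet> (M s *v u) = (1 - s) * (u \<bullet> u) + s * (u \<bullet> (A *v u))"
        by (simp add: M_def matrix_vector_mult_add_rdistrib scaleR_matrix_vector_assoc[symmetric]
            inner_add_right)
      moreover have "(1 - s) * (u \<bullet> u) + s * (u \<bullet> (A *v u)) > 0"
      proof (cases "s = 0")
        case False
        then show ?thesis
          using pos[OF u] \<open>0 \<le> s\<close> \<open>s \<le> 1\<close>
          by (intro add_nonneg_pos mult_nonneg_nonneg mult_pos_pos) auto
      qed (use u in simp)
      ultimately show False using \<open>M s *v u = 0\<close> by simp
    qed
    then show ?thesis
      using matrix_left_invertible_ker[of "M s"] invertible_left_inverse[of "M s"]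
        invertible_det_nz by blast
  qed
  have cont: "continuous_on {0..1} (\<lambda>s. det (M s))"
    unfolding det_def M_def by (intro continuous_intros) 
  show ?thesis
  proof (rule ccontr)
    assume "\<not> det A > 0"
    moreover have "det (M 0) = 1" "det (M 1) = det A" by (simp_all add: M_def det_I)
    ultimately have "\<exists>s. 0 \<le> s \<and> s \<le> 1 \<and> det (M s) = 0"
      using IVT2'[of "\<lambda>s. det (M s)" 1 0 0] cont by auto
    then show False using nz by blast
  qed
qed

section \<open>Derivatives of determinants and inverse matrices\<close>

text \<open>A permutation other than the identity moves at least two indices. After one factor of
  its Leibniz product has been differentiated, an off-diagonal entry of \<open>mat 1\<close> is
  left, so only the identity permutation contributes.\<close>

lemma has_real_derivative_det_mat1:
  fixes G :: "real \<Rightarrow> real^'n^'n"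
  assumes deriv: "\<And>i j. ((\<lambda>s. G s $ i $ j) has_real_derivative G' $ i $ j) (at z)"
    and "G z = mat 1"
  shows "((\<lambda>s. det (G s)) has_real_derivative trace G') (at z)"
proof -
  let ?D = "\<lambda>p. of_int (sign p) * (\<Sum>i\<in>UNIV. G' $ i $ p i * (\<Prod>j\<in>UNIV - {i}. G z $ j $ p j))"
  let ?P = "{p. p permutes (UNIV :: 'n set)}"
  have d: "((\<lambda>s. det (G s)) has_real_derivative (\<Sum>p\<in>?P. ?D p)) (at z)"
    unfolding det_def by (intro DERIV_sum DERIV_cmult has_field_derivative_prod deriv)
  have "?D p = (if p = id then trace G' else 0)" if "p permutes UNIV" for p :: "'n \<Rightarrow> 'n"
  proof (cases "p = id")
    case False
    have "(\<Prod>j\<in>UNIV - {i}. G z $ j $ p j) = 0" for i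
    proof -
      have "\<exists>j. j \<noteq> i \<and> p j \<noteq> j"
      proof (rule ccontr)
        assume "\<nexists>j. j \<noteq> i \<and> p j \<noteq> j"
        then have fixp: "\<And>j. j \<noteq> i \<Longrightarrow> p j = j" by blast
        have "p i = i" using fixp[of "p i"] permutes_inj[OF that] by (metis injD)
        with fixp False show False by (metis eq_id_iff)
      qed
      then obtain j where "j \<in> UNIV - {i}" "G z $ j $ p j = 0"
        using \<open>G z = mat 1\<close> by (auto simp: mat_def)
      then show ?thesis by (intro prod_zero) auto
    qed
    then have "?D p = 0" by (simp only: mult_zero_right sum.neutral_const)
    with False show ?thesis by simp
  qed (simp add: assms(2) mat_def trace_def sign_id)
  then have "(\<Sum>p\<in>?P. ?D p) = (\<Sum>p\<in>?P. if p = id then trace G' else 0)"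
    by (intro sum.cong) auto
  also have "\<dots> = trace G'" by (simp add: sum.delta finite_permutations permutes_id)
  finally show ?thesis using d by simp
qed

lemma has_real_derivative_matrix_mult:
  fixes A :: "real^'n^'m" and G :: "real \<Rightarrow> real^'k^'n"
  assumes "\<And>i j. ((\<lambda>s. G s $ i $ j) has_real_derivative G' $ i $ j) (at z)"
  shows "((\<lambda>s. (A ** G s) $ i $ j) has_real_derivative (A ** G') $ i $ j) (at z)"
  unfolding matrix_matrix_mult_def by (simp, intro DERIV_sum DERIV_cmult assms)

text \<open>Jacobi's formula: multiplying by the fixed matrix \<open>matrix_inv (G z)\<close> moves
  the base point to the identity.\<close>

lemma has_real_derivative_det:
  fixes G :: "real \<Rightarrow> real^'n^'n"
  assumes deriv: "\<And>i j. ((\<lambda>s. G s $ i $ j) has_real_derivative G' $ i $ j) (at z)"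
    and inv: "invertible (G z)"
  shows "((\<lambda>s. det (G s)) has_real_derivative det (G z) * trace (matrix_inv (G z) ** G')) (at z)"
proof -
  let ?H = "matrix_inv (G z)"
  have "((\<lambda>s. det (?H ** G s)) has_real_derivative trace (?H ** G')) (at z)"
    by (intro has_real_derivative_det_mat1 has_real_derivative_matrix_mult deriv)
      (simp add: matrix_inv_left[OF inv])
  then have "((\<lambda>s. det (G z) * det (?H ** G s)) has_real_derivative
      det (G z) * trace (?H ** G')) (at z)"
    by (rule DERIV_cmult)
  moreover have "det (G z) * det (?H ** G s) = det (G s)" for s
    using matrix_inv_right[OF inv] by (metis det_mul matrix_mul_assoc matrix_mul_lid)
  ultimately show ?thesis by simp
qed

lemma differentiable_det:
  fixes G :: "real \<Rightarrow> real^'n^'n"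
  assumes "\<And>i j. (\<lambda>s. G s $ i $ j) field_differentiable (at z)"
  shows "(\<lambda>s. det (G s)) field_differentiable (at z)"
proof -
  obtain G' where "\<And>i j. ((\<lambda>s. G s $ i $ j) has_real_derivative G' i j) (at z)"
    using assms unfolding field_differentiable_def by metis
  then show ?thesis
    unfolding field_differentiable_def det_def
    apply -
    apply (rule exI)
    apply (rule DERIV_sum DERIV_cmult has_field_derivative_prod | assumption)+
    done
qed

text \<open>Cramer's rule supplies the existence of the derivative; its value then follows by
  differentiating the constant product of the inverse with \<open>G s\<close>.\<close>

lemma has_real_derivative_matrix_inv:
  fixes G :: "real \<Rightarrow> real^'n^'n"
  assumes deriv: "\<And>i j. ((\<lambda>s. G s $ i $ j) has_real_derivative G' $ i $ j) (at z)"
    and inv: "\<And>s. invertible (G s)"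
  shows "((\<lambda>s. matrix_inv (G s) $ i $ j) has_real_derivative
    - (matrix_inv (G z) ** G' ** matrix_inv (G z)) $ i $ j) (at z)"
proof -
  let ?H = "\<lambda>s. matrix_inv (G s)"
  have nz: "det (G s) \<noteq> 0" for s using inv invertible_det_nz by blast
  have fd: "(\<lambda>s. G s $ i $ j) field_differentiable (at z)" for i j
    using deriv field_differentiable_def by blast
  have "(\<lambda>s. ?H s $ i $ j) field_differentiable (at z)" for i j
  proof -
    have "(\<lambda>s. (\<chi> p q. if q = i then axis j 1 $ p else G s $ p $ q) $ p $ q)
        field_differentiable (at z)" for p q
      using fd by (cases "q = i") (simp_all add: field_differentiable_const)
    then show ?thesis
      unfolding matrix_inv_cramer[OF nz]
      by (intro field_differentiable_divide differentiable_det fd nz)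
  qed
  then obtain H' where H': "\<And>i j. ((\<lambda>s. ?H s $ i $ j) has_real_derivative H' i j) (at z)"
    unfolding field_differentiable_def by metis
  define H1 where "H1 = (\<chi> i j. H' i j)"
  have H1: "((\<lambda>s. ?H s $ i $ j) has_real_derivative H1 $ i $ j) (at z)" for i j
    using H' by (simp add: H1_def)
  have "(H1 ** G z + ?H z ** G') $ i $ j = 0" for i j
  proof -
    have "((\<lambda>s. (?H s ** G s) $ i $ j) has_real_derivative (H1 ** G z + ?H z ** G') $ i $ j) (at z)"
      unfolding matrix_matrix_mult_def
      by (auto simp: sum.distrib[symmetric] intro!: DERIV_sum derivative_eq_intros H1 deriv)
    moreover have "(\<lambda>s. (?H s ** G s) $ i $ j) = (\<lambda>s. (mat 1 :: real^'n^'n) $ i $ j)"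
      using matrix_inv_left[OF inv] by simp
    ultimately show ?thesis using DERIV_unique DERIV_const by metis
  qed
  then have "H1 ** G z + ?H z ** G' = 0" by (simp add: vec_eq_iff)
  then have "H1 ** G z = - (?H z ** G')" by (simp add: add_eq_0_iff2)
  then have "H1 ** G z ** ?H z = - (?H z ** G') ** ?H z" by simp
  then have "H1 = - (?H z ** G' ** ?H z)"
    using matrix_inv_right[OF inv]
    by (simp add: matrix_mul_assoc[symmetric] matrix_mul_minus_left)
  then show ?thesis using H1[of i j] by simp
qed

subsection \<open>Convexity of the area integrand\<close>

text \<open>For \<open>P\<close> the Jacobian matrix of a map, this is the first fundamental form of
  its graph.\<close>

definition gram :: "real^'n^'m \<Rightarrow> real^'n^'n" where
  "gram P = mat 1 + transpose P ** P"

definition area_density :: "real^'n^'m \<Rightarrow> real" where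
  "area_density P = sqrt (det (gram P))"

lemma matrix_add_rdistrib: "(A + B) ** C = A ** C + B ** C" for A :: "'a::semiring_1^'n^'m"
  by (simp add: vec_eq_iff matrix_matrix_mult_def sum.distrib distrib_right)

lemma transpose_add: "transpose (A + B) = transpose A + transpose B"
  by (simp add: transpose_def vec_eq_iff)

lemma transpose_gram: "transpose (gram P) = gram P"
  by (simp add: gram_def transpose_add matrix_transpose_mul transpose_mat)

lemma gram_mult_vec: "gram P *v u = u + transpose P *v (P *v u)"
  by (simp add: gram_def matrix_vector_mult_add_rdistrib matrix_vector_mul_assoc)

lemma inner_gram: "u \<bullet> (gram P *v u) = u \<bullet> u + (P *v u) \<bullet> (P *v u)"
  by (simp only: gram_mult_vec inner_add_right inner_transpose_mult)

lemma det_gram_pos: "det (gram P) > 0"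
  by (rule det_pos_definite) (simp add: inner_gram add_pos_nonneg)

lemma invertible_gram: "invertible (gram P)"
  using det_gram_pos[of P] invertible_det_nz by force

lemma area_density_pos: "area_density P > 0"
  by (simp add: area_density_def det_gram_pos)

lemma transpose_inv_gram: "transpose (matrix_inv (gram P)) = matrix_inv (gram P)"
  by (rule transpose_matrix_inv_symmetric[OF invertible_gram transpose_gram])

text \<open>This is where lengths not being increased matters: it bounds
  \<open>\<sigma>^2 / (1 + \<sigma>^2)\<close> by 1/2 for every singular value \<sigma> of
  \<open>P\<close>. The proof avoids singular values by solving
  \<open>gram P *v u = transpose P *v c\<close>.\<close>

lemma inner_inv_gram_le:
  fixes P :: "real^'n^'m" and c :: "real^'m"
  assumes short: "\<And>v. norm (P *v v) \<le> norm v"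
  shows "c \<bullet> ((P ** matrix_inv (gram P) ** transpose P) *v c) \<le> (c \<bullet> c) / 2"
proof -
  define u where "u = matrix_inv (gram P) *v (transpose P *v c)"
  have "gram P *v u = transpose P *v c"
    by (simp add: u_def matrix_vector_mul_assoc matrix_inv_right[OF invertible_gram])
  then have "u \<bullet> u + (P *v u) \<bullet> (P *v u) = u \<bullet> (transpose P *v c)"
    using inner_gram[of u P] by simp
  also have "\<dots> = c \<bullet> (P *v u)"
    by (simp only: inner_transpose_mult inner_commute)
  finally have *: "u \<bullet> u + (P *v u) \<bullet> (P *v u) = c \<bullet> (P *v u)" .
  have "(P *v u) \<bullet> (P *v u) \<le> u \<bullet> u"
    using short[of u] by (simp add: norm_le)
  \<comment> \<open>With \<open>s = c \<bullet> (P *v u)\<close>, the identity \<open>*\<close> and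
    the previous bound give \<open>2 |P u|^2 \<le> s\<close>; the square gives
    \<open>4 s \<le> |c|^2 + 4 |P u|^2 \<le> |c|^2 + 2 s\<close>.\<close>
  moreover have "(c - 2 *\<^sub>R (P *v u)) \<bullet> (c - 2 *\<^sub>R (P *v u)) \<ge> 0" by simp
  then have "c \<bullet> c - 4 * (c \<bullet> (P *v u)) + 4 * ((P *v u) \<bullet> (P *v u)) \<ge> 0"
    by (simp add: inner_diff_left inner_diff_right inner_commute)
  ultimately have "c \<bullet> (P *v u) \<le> (c \<bullet> c) / 2"
    using * by linarith
  then show ?thesis
    by (simp add: u_def matrix_vector_mul_assoc matrix_mul_assoc del: transpose_matrix_vector)
qed

lemma trace_conjugate:
  fixes R :: "real^'k^'m" and M :: "real^'m^'m"
  shows "trace (transpose R ** M ** R) = (\<Sum>k\<in>UNIV. column k R \<bullet> (M *v column k R))"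
proof -
  have "(transpose R ** (M ** R)) $ k $ k = column k R \<bullet> (M *v column k R)" for k
    by (simp add: matrix_matrix_mult_def transpose_def column_def matrix_vector_mult_def inner_vec_def)
  then show ?thesis by (simp add: trace_def matrix_mul_assoc[symmetric])
qed

lemma trace_transpose: "trace (transpose A) = trace A"
  by (simp add: trace_def transpose_def)

lemma trace_mul_self_le:
  fixes A :: "real^'k^'k"
  shows "trace (A ** A) \<le> trace (transpose A ** A)"
proof -
  have "2 * (A $ i $ j * A $ j $ i) \<le> A $ i $ j * A $ i $ j + A $ j $ i * A $ j $ i" for i j
    using sum_squares_bound[of "A$i$j" "A$j$i"] by (simp add: power2_eq_square)
  then have "(\<Sum>i\<in>UNIV. \<Sum>j\<in>UNIV. 2 * (A $ i $ j * A $ j $ i))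
      \<le> (\<Sum>i\<in>UNIV. \<Sum>j\<in>UNIV. A $ i $ j * A $ i $ j + A $ j $ i * A $ j $ i)"
    by (intro sum_mono)
  moreover have "(\<Sum>i\<in>UNIV. \<Sum>j\<in>UNIV. A $ i $ j * A $ i $ j)
      = (\<Sum>i\<in>UNIV. \<Sum>j\<in>UNIV. A $ j $ i * A $ j $ i)"
    by (rule sum.swap)
  ultimately show ?thesis
    by (simp add: trace_def matrix_matrix_mult_def transpose_def sum.distrib sum_distrib_left[symmetric])
qed

lemma inv_gram_factor:
  fixes P :: "real^'n^'m"
  obtains C :: "real^('n + 'm)^'n" where "C ** transpose C = matrix_inv (gram P)"
proof -
  define H where "H = matrix_inv (gram P)"
  define K where "K = H ** transpose P"
  define C :: "real^('n + 'm)^'n"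
    where "C = (\<chi> i k. case k of Inl j \<Rightarrow> H $ i $ j | Inr l \<Rightarrow> K $ i $ l)"
  \<comment> \<open>\<open>C\<close> is the block matrix \<open>(H | H P\<^sup>T)\<close>; this avoids a square root of \<open>H\<close>.\<close>
  have "C ** transpose C = H ** transpose H + K ** transpose K"
    by (simp add: C_def vec_eq_iff matrix_matrix_mult_def transpose_def UNIV_Plus_UNIV[symmetric]
        sum.Plus del: UNIV_Plus_UNIV)
  also have "\<dots> = H ** gram P ** H"
    by (simp add: K_def H_def transpose_inv_gram matrix_transpose_mul)
      (simp add: gram_def matrix_add_ldistrib matrix_add_rdistrib matrix_mul_assoc)
  also have "\<dots> = H" by (simp add: H_def matrix_inv_left[OF invertible_gram])
  finally show thesis using that by (simp add: H_def)
qed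

text \<open>The second derivative of \<open>ln (area_density (P + s Q))\<close> at \<open>s = 0\<close> is the difference of the two
  sides.\<close>

lemma log_area_hessian_nonneg:
  fixes P Q :: "real^'n^'m"
  assumes short: "\<And>v. norm (P *v v) \<le> norm v"
  defines "H \<equiv> matrix_inv (gram P)" and "N \<equiv> transpose P ** Q"
  shows "trace (H ** (N + transpose N) ** H ** N) \<le> trace (H ** transpose Q ** Q)"
proof -
  obtain C :: "real^('n + 'm)^'n" where C: "C ** transpose C = H"
    unfolding H_def by (rule inv_gram_factor)
  \<comment> \<open>Conjugation by \<open>C\<close> turns traces weighted by \<open>H\<close> into
    plain traces of products, where the symmetric and the mixed term can be compared by
    \<open>trace_mul_self_le\<close>.\<close>
  define A where "A = transpose C ** N ** C"
  define R where "R = Q ** C"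
  have cyc: "trace (H ** M) = trace (transpose C ** M ** C)" for M
    using trace_mul_sym[of C "transpose C ** M"] by (simp add: C[symmetric] matrix_mul_assoc)
  have "trace (H ** (N + transpose N) ** H ** N)
      = trace (transpose C ** ((N + transpose N) ** H ** N) ** C)"
    using cyc[of "(N + transpose N) ** H ** N"] by (simp add: matrix_mul_assoc)
  also have "transpose C ** ((N + transpose N) ** H ** N) ** C = (A + transpose A) ** A"
    by (simp add: A_def C[symmetric] matrix_transpose_mul matrix_add_ldistrib matrix_add_rdistrib
        matrix_mul_assoc)
  also have "trace \<dots> = trace (A ** A) + trace (transpose A ** A)"
    by (simp add: matrix_add_rdistrib trace_add)
  also have "\<dots> \<le> 2 * trace (transpose A ** A)" using trace_mul_self_le[of A] by simp
  also have "transpose A ** A = transpose R ** (P ** H ** transpose P) ** R"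
    by (simp add: A_def R_def N_def C[symmetric] matrix_transpose_mul matrix_mul_assoc)
  \<comment> \<open>The bound 1/2 is applied to each column of \<open>R\<close>; it exactly absorbs
    the factor 2 produced by the two trace terms.\<close>
  also have "2 * trace \<dots> \<le> trace (transpose R ** mat 1 ** R)"
    unfolding trace_conjugate sum_distrib_left
    using inner_inv_gram_le[OF short] by (intro sum_mono) (simp add: H_def mult.commute)
  also have "\<dots> = trace (H ** transpose Q ** Q)"
    using cyc[of "transpose Q ** Q"] by (simp add: R_def matrix_transpose_mul matrix_mul_assoc)
  finally show ?thesis .
qed

text \<open>The unit ball of the operator norm is convex, so the whole segment from \<open>P\<close>
  to \<open>P + Q\<close> satisfies the Hessian estimate. The logarithm of the density then lies
  above its tangent, and \<open>exp t \<ge> 1 + t\<close> turns this into a supporting hyperplane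
  for the density itself.\<close>

lemma area_density_tangent_le:
  fixes P Q :: "real^'n^'m"
  assumes P: "\<And>v. norm (P *v v) \<le> norm v" and PQ: "\<And>v. norm ((P + Q) *v v) \<le> norm v"
  shows "area_density P * (1 + trace (matrix_inv (gram P) ** transpose P ** Q))
    \<le> area_density (P + Q)"
proof -
  define p where "p s = P + s *\<^sub>R Q" for s :: real
  define H where "H s = matrix_inv (gram (p s))" for s
  define N where "N s = transpose (p s) ** Q" for s
  \<comment> \<open>The division by 2 accounts for the square root: \<psi> is the logarithm of
    \<open>area_density (p s)\<close>, and \<theta> will be its derivative.\<close>
  define \<psi> where "\<psi> s = ln (det (gram (p s))) / 2" for s
  define \<theta> where "\<theta> s = trace (H s ** N s)" for s
  have short: "norm (p s *v v) \<le> norm v" if "0 \<le> s" "s \<le> 1" for s v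
  proof -
    have "p s *v v = (1 - s) *\<^sub>R (P *v v) + s *\<^sub>R ((P + Q) *v v)"
      by (simp add: p_def matrix_vector_mult_add_rdistrib scaleR_matrix_vector_assoc[symmetric]
          algebra_simps)
    also have "norm \<dots> \<le> (1 - s) * norm (P *v v) + s * norm ((P + Q) *v v)"
      using that by (intro order_trans[OF norm_triangle_ineq]) simp
    also have "\<dots> \<le> (1 - s) * norm v + s * norm v"
      using that P PQ by (intro add_mono mult_left_mono) auto
    finally show ?thesis by (simp add: algebra_simps)
  qed
  have dG: "((\<lambda>s. gram (p s) $ i $ j) has_real_derivative (N z + transpose (N z)) $ i $ j) (at z)"
    for i j z
    unfolding gram_def p_def N_def matrix_matrix_mult_def transpose_def
    by (auto simp: sum.distrib[symmetric] algebra_simps intro!: derivative_eq_intros)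
  have dN: "((\<lambda>s. N s $ i $ j) has_real_derivative (transpose Q ** Q) $ i $ j) (at z)" for i j z
    unfolding p_def N_def matrix_matrix_mult_def transpose_def
    by (auto simp: sum.distrib[symmetric] algebra_simps intro!: derivative_eq_intros)
  have d\<psi>: "(\<psi> has_real_derivative \<theta> z) (at z)" for z
  proof -
    have "trace (H z ** transpose (N z)) = trace (N z ** H z)"
      using trace_transpose[of "N z ** H z"]
      by (simp add: matrix_transpose_mul H_def transpose_inv_gram)
    also have "\<dots> = trace (H z ** N z)" by (rule trace_mul_sym)
    finally have *: "trace (H z ** (N z + transpose (N z))) = 2 * \<theta> z"
      by (simp add: matrix_add_ldistrib trace_add \<theta>_def)
    show ?thesis
      unfolding \<psi>_def
      by (rule derivative_eq_intros has_real_derivative_det[OF dG invertible_gram] refl det_gram_pos)+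
        (use * det_gram_pos[of "p z"] in \<open>auto simp: H_def\<close>)
  qed
  have dH: "((\<lambda>s. H s $ i $ j) has_real_derivative
      - (H z ** (N z + transpose (N z)) ** H z) $ i $ j) (at z)" for i j z
    unfolding H_def by (rule has_real_derivative_matrix_inv[OF dG invertible_gram])
  have d\<theta>: "(\<theta> has_real_derivative trace (H z ** transpose Q ** Q)
      - trace (H z ** (N z + transpose (N z)) ** H z ** N z)) (at z)" for z
  proof -
    let ?S = "H z ** (N z + transpose (N z)) ** H z"
    have d: "(\<theta> has_real_derivative (\<Sum>i\<in>UNIV. \<Sum>j\<in>UNIV.
        - ?S $ i $ j * N z $ j $ i + (transpose Q ** Q) $ j $ i * H z $ i $ j)) (at z)"
    proof -
      have "((\<lambda>s. H s $ i $ j * N s $ j $ i) has_real_derivative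
          - ?S $ i $ j * N z $ j $ i + (transpose Q ** Q) $ j $ i * H z $ i $ j) (at z)" for i j
        by (intro DERIV_mult dH dN)
      then have "((\<lambda>s. \<Sum>i\<in>UNIV. \<Sum>j\<in>UNIV. H s $ i $ j * N s $ j $ i) has_real_derivative
          (\<Sum>i\<in>UNIV. \<Sum>j\<in>UNIV.
            - ?S $ i $ j * N z $ j $ i + (transpose Q ** Q) $ j $ i * H z $ i $ j)) (at z)"
        by (intro DERIV_sum)
      moreover have "\<theta> = (\<lambda>s. \<Sum>i\<in>UNIV. \<Sum>j\<in>UNIV. H s $ i $ j * N s $ j $ i)"
        by (simp add: \<theta>_def trace_def matrix_matrix_mult_def fun_eq_iff)
      ultimately show ?thesis by simp
    qed
    have "trace (?S ** N z) = (\<Sum>i\<in>UNIV. \<Sum>j\<in>UNIV. ?S $ i $ j * N z $ j $ i)"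
      by (simp only: trace_def matrix_matrix_mult_def[of ?S] vec_lambda_beta)
    moreover have "trace (H z ** (transpose Q ** Q))
        = (\<Sum>i\<in>UNIV. \<Sum>j\<in>UNIV. (transpose Q ** Q) $ j $ i * H z $ i $ j)"
      by (simp only: trace_def matrix_matrix_mult_def[of "H z"] vec_lambda_beta mult.commute[of "H z $ _ $ _"])
    ultimately have eq: "(\<Sum>i\<in>UNIV. \<Sum>j\<in>UNIV.
        - ?S $ i $ j * N z $ j $ i + (transpose Q ** Q) $ j $ i * H z $ i $ j)
      = trace (H z ** (transpose Q ** Q)) - trace (?S ** N z)"
      by (simp only: sum.distrib sum_negf mult_minus_left add.commute diff_conv_add_uminus)
    have assoc: "H z ** (transpose Q ** Q) = H z ** transpose Q ** Q"
      by (rule matrix_mul_assoc)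
    show ?thesis
      using d
      unfolding eq
      unfolding assoc
      by assumption
  qed
  have mono: "\<theta> 0 \<le> \<theta> z" if "0 \<le> z" "z \<le> 1" for z
  proof (rule DERIV_nonneg_imp_nondecreasing[OF that(1)])
    fix x assume "0 \<le> x" "x \<le> z"
    then have "trace (H x ** (N x + transpose (N x)) ** H x ** N x) \<le> trace (H x ** transpose Q ** Q)"
      using that unfolding H_def N_def by (intro log_area_hessian_nonneg short) auto
    then show "\<exists>y. (\<theta> has_real_derivative y) (at x) \<and> 0 \<le> y" using d\<theta>[of x] by force
  qed
  obtain z where z: "0 < z" "z < 1" "\<psi> 1 - \<psi> 0 = (1 - 0) * \<theta> z"
    using MVT2[of 0 1 \<psi> \<theta>] d\<psi> by auto
  then have "\<theta> 0 \<le> \<psi> 1 - \<psi> 0" using mono[of z] by simp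
  then have "1 + \<theta> 0 \<le> exp (\<psi> 1 - \<psi> 0)" using exp_ge_add_one_self[of "\<psi> 1 - \<psi> 0"] by linarith
  then have "area_density P * (1 + \<theta> 0) \<le> area_density P * exp (\<psi> 1 - \<psi> 0)"
    using area_density_pos[of P] by (intro mult_left_mono) auto
  also have "\<dots> = area_density (P + Q)"
  proof -
    have "exp (\<psi> s) = area_density (p s)" for s
      using det_gram_pos[of "p s"] by (simp add: \<psi>_def area_density_def ln_sqrt[symmetric])
    then show ?thesis
      using area_density_pos[of P] by (simp add: exp_diff p_def)
  qed
  finally show ?thesis by (simp add: \<theta>_def H_def N_def p_def matrix_mul_assoc)
qed

subsection \<open>Calculus of continuously differentiable maps\<close>

lemma Ck_on_cong:
  assumes "open S" and "\<And>x. x \<in> S \<Longrightarrow> f x = g x" and "Ck_on k S f"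
  shows "Ck_on k S g"
  using assms(2,3)
proof (induction k arbitrary: f g)
  case 0
  then show ?case using continuous_on_cong by force
next
  case (Suc k)
  have D: "frechet_derivative f (at x) = frechet_derivative g (at x) \<and> g differentiable at x"
    if "x \<in> S" for x
  proof -
    have "(f has_derivative frechet_derivative f (at x)) (at x)"
      using Suc.prems that frechet_derivative_works by auto
    then have "(g has_derivative frechet_derivative f (at x)) (at x)"
      using has_derivative_transform_within_open[OF _ assms(1) that] Suc.prems(1) by blast
    then show ?thesis using frechet_derivative_at differentiableI by blast
  qed
  have "Ck_on k S (\<lambda>x. frechet_derivative g (at x) v)" for v
  proof (rule Suc.IH)
    show "Ck_on k S (\<lambda>x. frechet_derivative f (at x) v)" using Suc.prems(2) by simp
    show "frechet_derivative f (at x) v = frechet_derivative g (at x) v" if "x \<in> S" for x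
      using D[OF that] by metis
  qed
  then show ?case using D by simp
qed

text \<open>By uniqueness of derivatives, an explicitly computed derivative may replace
  \<open>frechet_derivative\<close>, in terms of which \<open>Ck_on\<close> is defined. The
  inductive closure rules below all pass through this rule.\<close>

lemma Ck_on_SucI:
  assumes "open S" and "\<And>x. x \<in> S \<Longrightarrow> (f has_derivative f' x) (at x)"
    and "\<And>v. Ck_on k S (\<lambda>x. f' x v)"
  shows "Ck_on (Suc k) S f"
proof -
  have "Ck_on k S (\<lambda>x. frechet_derivative f (at x) v)" for v
    using assms(2) by (intro Ck_on_cong[OF assms(1) _ assms(3)[of v]])
      (metis frechet_derivative_at)
  moreover have "f differentiable (at x)" if "x \<in> S" for x
    using assms(2)[OF that] by (rule differentiableI)
  ultimately show ?thesis by simp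
qed

lemma Ck_on_Suc_has_derivative:
  assumes "Ck_on (Suc k) S f" and "x \<in> S"
  shows "(f has_derivative frechet_derivative f (at x)) (at x)"
  using assms frechet_derivative_works by auto

lemma Ck_on_SucD: "Ck_on (Suc k) S f \<Longrightarrow> Ck_on k S (\<lambda>x. frechet_derivative f (at x) v)"
  by simp

lemma Ck_on_Suc_imp: "Ck_on (Suc k) S f \<Longrightarrow> Ck_on k S f"
proof (induction k arbitrary: f)
  case 0
  then show ?case
    by (simp add: continuous_at_imp_continuous_on differentiable_imp_continuous_within)
qed simp

lemma Ck_on_imp_continuous_on: "Ck_on k S f \<Longrightarrow> continuous_on S f"
proof (induction k)
  case (Suc k)
  then show ?case using Ck_on_Suc_imp by blast
qed simp

lemma Ck_on_const: "Ck_on k S (\<lambda>x. c)"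
  by (induction k arbitrary: c) (auto intro: continuous_on_const)

lemma Ck_on_add:
  assumes "open S" and "Ck_on k S f" and "Ck_on k S g"
  shows "Ck_on k S (\<lambda>x. f x + g x)"
  using assms(2,3)
proof (induction k arbitrary: f g)
  case (Suc k)
  note D = Ck_on_Suc_has_derivative[OF Suc.prems(1)] Ck_on_Suc_has_derivative[OF Suc.prems(2)]
  show ?case
    by (rule Ck_on_SucI[OF assms(1) has_derivative_add[OF D]])
      (assumption | intro Suc.IH Ck_on_SucD Suc.prems)+
qed (auto intro: continuous_on_add)

lemma Ck_on_bounded_linear:
  assumes "open S" and "bounded_linear L" and "Ck_on k S f"
  shows "Ck_on k S (\<lambda>x. L (f x))"
  using assms(3)
proof (induction k arbitrary: f)
  case 0
  then show ?case using bounded_linear.continuous_on[OF assms(2)] by simp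
next
  case (Suc k)
  note D = Ck_on_Suc_has_derivative[OF Suc.prems]
  show ?case
    by (rule Ck_on_SucI[OF assms(1) bounded_linear.has_derivative[OF assms(2) D]])
      (assumption | intro Suc.IH Ck_on_SucD Suc.prems)+
qed

text \<open>One induction serves products, inner products and scaling. The product rule also
  contains the undifferentiated factors, which are lowered from order \<open>Suc k\<close> to order
  \<open>k\<close>.\<close>

lemma Ck_on_bounded_bilinear:
  assumes "open S" and "bounded_bilinear b" and "Ck_on k S f" and "Ck_on k S g"
  shows "Ck_on k S (\<lambda>x. b (f x) (g x))"
  using assms(3,4)
proof (induction k arbitrary: f g)
  case 0
  then show ?case using bounded_bilinear.continuous_on[OF assms(2)] by simp
next
  case (Suc k)
  note D = Ck_on_Suc_has_derivative[OF Suc.prems(1)] Ck_on_Suc_has_derivative[OF Suc.prems(2)]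
  show ?case
    by (rule Ck_on_SucI[OF assms(1) bounded_bilinear.FDERIV[OF assms(2) D]])
      (assumption | intro Ck_on_add assms(1) Suc.IH Ck_on_SucD Ck_on_Suc_imp[OF Suc.prems(1)]
        Ck_on_Suc_imp[OF Suc.prems(2)] Suc.prems)+
qed

lemmas Ck_on_mult = Ck_on_bounded_bilinear[OF _ bounded_bilinear_mult]
lemmas Ck_on_inner = Ck_on_bounded_bilinear[OF _ bounded_bilinear_inner]
lemmas Ck_on_scaleR = Ck_on_bounded_bilinear[OF _ bounded_bilinear_scaleR]

lemma Ck_on_sum:
  assumes "open S" and "\<And>i. i \<in> I \<Longrightarrow> Ck_on k S (f i)"
  shows "Ck_on k S (\<lambda>x. \<Sum>i\<in>I. f i x)"
  using assms(2) by (induction I rule: infinite_finite_induct)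
    (auto intro: Ck_on_const Ck_on_add assms(1))

lemma Ck_on_prod:
  fixes f :: "'i \<Rightarrow> 'a::real_normed_vector \<Rightarrow> 'b::real_normed_field"
  assumes "open S" and "\<And>i. i \<in> I \<Longrightarrow> Ck_on k S (f i)"
  shows "Ck_on k S (\<lambda>x. \<Prod>i\<in>I. f i x)"
  using assms(2) by (induction I rule: infinite_finite_induct)
    (auto intro: Ck_on_const Ck_on_mult assms(1))

text \<open>The derivative of the inverse contains only the inverse itself and the derivative of
  \<open>f\<close>, so the induction hypothesis for the same \<open>f\<close> closes the step. The
  square root is handled in the same way.\<close>

lemma Ck_on_inverse:
  fixes f :: "'a::real_normed_vector \<Rightarrow> real"
  assumes "open S" and "Ck_on k S f" and nz: "\<And>x. x \<in> S \<Longrightarrow> f x \<noteq> 0"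
  shows "Ck_on k S (\<lambda>x. inverse (f x))"
  using assms(2)
proof (induction k)
  case 0
  then show ?case using nz by (auto intro: continuous_on_inverse)
next
  case (Suc k)
  have "Ck_on k S (\<lambda>x. inverse (f x))" by (rule Suc.IH[OF Ck_on_Suc_imp[OF Suc.prems]])
  then have "Ck_on k S (\<lambda>x. - 1 * (inverse (f x) * frechet_derivative f (at x) v * inverse (f x)))" for v
    using Suc.prems by (intro Ck_on_mult Ck_on_const assms(1)) auto
  moreover have "((\<lambda>x. inverse (f x)) has_derivative
      (\<lambda>v. - 1 * (inverse (f x) * frechet_derivative f (at x) v * inverse (f x)))) (at x)"
    if "x \<in> S" for x
    using nz[OF that] Ck_on_Suc_has_derivative[OF Suc.prems that]
    by (auto intro!: derivative_eq_intros)
  ultimately show ?case by (rule Ck_on_SucI[OF assms(1), rotated])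
qed

lemma Ck_on_sqrt:
  fixes f :: "'a::real_normed_vector \<Rightarrow> real"
  assumes "open S" and "Ck_on k S f" and pos: "\<And>x. x \<in> S \<Longrightarrow> f x > 0"
  shows "Ck_on k S (\<lambda>x. sqrt (f x))"
  using assms(2)
proof (induction k)
  case 0
  then show ?case by (auto intro: continuous_on_real_sqrt)
next
  case (Suc k)
  have "Ck_on k S (\<lambda>x. sqrt (f x))" by (rule Suc.IH[OF Ck_on_Suc_imp[OF Suc.prems]])
  then have "Ck_on k S (\<lambda>x. inverse (sqrt (f x)))"
    using pos by (intro Ck_on_inverse assms(1)) force+
  then have "Ck_on k S (\<lambda>x. frechet_derivative f (at x) v * (inverse (sqrt (f x)) * (1/2)))" for v
    using Suc.prems by (intro Ck_on_mult Ck_on_const assms(1)) auto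
  moreover have "((\<lambda>x. sqrt (f x)) has_derivative
      (\<lambda>v. frechet_derivative f (at x) v * (inverse (sqrt (f x)) * (1/2)))) (at x)" if "x \<in> S" for x
    using pos[OF that] Ck_on_Suc_has_derivative[OF Suc.prems that]
    by (auto intro!: derivative_eq_intros simp: field_simps)
  ultimately show ?case by (rule Ck_on_SucI[OF assms(1), rotated])
qed

lemma Ck_on_det:
  fixes G :: "'a::real_normed_vector \<Rightarrow> real^'n^'n"
  assumes "open S" and "\<And>i j. Ck_on k S (\<lambda>x. G x $ i $ j)"
  shows "Ck_on k S (\<lambda>x. det (G x))"
  unfolding det_def by (intro Ck_on_sum Ck_on_mult Ck_on_const Ck_on_prod assms)

section \<open>Derivatives along lines and symmetry of second derivatives\<close>

lemma has_vector_derivative_line: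
  assumes "f differentiable (at (a + s *\<^sub>R u))"
  shows "((\<lambda>s. f (a + s *\<^sub>R u)) has_vector_derivative frechet_derivative f (at (a + s *\<^sub>R u)) u) (at s)"
proof -
  let ?D = "frechet_derivative f (at (a + s *\<^sub>R u))"
  have D: "(f has_derivative ?D) (at (a + s *\<^sub>R u))"
    using assms frechet_derivative_works by blast
  have "((\<lambda>s. a + s *\<^sub>R u) has_derivative (\<lambda>t. t *\<^sub>R u)) (at s)"
    by (auto intro!: derivative_eq_intros)
  then have "((\<lambda>s. f (a + s *\<^sub>R u)) has_derivative (\<lambda>t. ?D (t *\<^sub>R u))) (at s)"
    using D by (rule has_derivative_compose)
  then show ?thesis
    using linear_scale[OF has_derivative_linear[OF D]] by (simp add: has_vector_derivative_def)
qed

text \<open>The mean value theorem is applied along \<open>u\<close> and then along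
  \<open>v\<close>. The second difference is symmetric in the two directions, which is what forces
  the mixed derivatives to agree.\<close>

lemma second_difference_mean_value:
  fixes f :: "'a::real_normed_vector \<Rightarrow> real"
  assumes f: "Ck_on 2 S f" and ball: "cball x (h * (norm u + norm v)) \<subseteq> S" and "h > 0"
  shows "\<exists>p\<in>cball x (h * (norm u + norm v)).
    f (x + h *\<^sub>R u + h *\<^sub>R v) - f (x + h *\<^sub>R u) - f (x + h *\<^sub>R v) + f x
      = h * (h * frechet_derivative (\<lambda>y. frechet_derivative f (at y) u) (at p) v)"
proof -
  have f': "Ck_on (Suc (Suc 0)) S f" using f by (simp add: numeral_2_eq_2)
  define D where "D y = frechet_derivative f (at y) u" for y
  define DD where "DD y = frechet_derivative D (at y) v" for y
  have near: "x + s *\<^sub>R u + t *\<^sub>R v \<in> cball x (h * (norm u + norm v))"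
    if "0 \<le> s" "s \<le> h" "0 \<le> t" "t \<le> h" for s t
  proof -
    have "norm (s *\<^sub>R u + t *\<^sub>R v) \<le> s * norm u + t * norm v"
      using that by (intro order_trans[OF norm_triangle_ineq]) simp
    also have "\<dots> \<le> h * norm u + h * norm v"
      using that by (intro add_mono mult_right_mono) auto
    finally have "norm (s *\<^sub>R u + t *\<^sub>R v) \<le> h * (norm u + norm v)" by (simp add: distrib_left)
    moreover have "x - (x + s *\<^sub>R u + t *\<^sub>R v) = - (s *\<^sub>R u + t *\<^sub>R v)" by simp
    ultimately show ?thesis by (simp only: mem_cball dist_norm norm_minus_cancel)
  qed
  have inS: "x + s *\<^sub>R u + t *\<^sub>R v \<in> S" if "0 \<le> s" "s \<le> h" "0 \<le> t" "t \<le> h" for s t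
    using near[OF that] ball by blast
  have df: "((\<lambda>s. f (a + s *\<^sub>R u)) has_real_derivative D (a + s *\<^sub>R u)) (at s)"
    if "a + s *\<^sub>R u \<in> S" for a s
    using has_vector_derivative_line[of f a s u] f' that
    by (simp add: D_def has_real_derivative_iff_has_vector_derivative)
  have dD: "((\<lambda>t. D (a + t *\<^sub>R v)) has_real_derivative DD (a + t *\<^sub>R v)) (at t)"
    if "a + t *\<^sub>R v \<in> S" for a t
    using has_vector_derivative_line[of D a t v] f' that
    by (simp add: D_def[abs_def] DD_def has_real_derivative_iff_has_vector_derivative)
  define \<phi> where "\<phi> s = f (x + h *\<^sub>R v + s *\<^sub>R u) - f (x + s *\<^sub>R u)" for s
  have "(\<phi> has_real_derivative D (x + h *\<^sub>R v + s *\<^sub>R u) - D (x + s *\<^sub>R u)) (at s)"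
    if "0 \<le> s" "s \<le> h" for s
    unfolding \<phi>_def using inS[OF that, of h] inS[OF that, of 0] \<open>h > 0\<close>
    by (intro DERIV_diff df) (auto simp: algebra_simps)
  then obtain s where s: "0 < s" "s < h"
    "\<phi> h - \<phi> 0 = (h - 0) * (D (x + h *\<^sub>R v + s *\<^sub>R u) - D (x + s *\<^sub>R u))"
    using MVT2[of 0 h \<phi> "\<lambda>s. D (x + h *\<^sub>R v + s *\<^sub>R u) - D (x + s *\<^sub>R u)"] \<open>h > 0\<close>
    by metis
  have "((\<lambda>t. D (x + s *\<^sub>R u + t *\<^sub>R v)) has_real_derivative DD (x + s *\<^sub>R u + t *\<^sub>R v)) (at t)"
    if "0 \<le> t" "t \<le> h" for t
    using inS[of s t] s that by (intro dD) auto
  then obtain t where t: "0 < t" "t < h"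
    "D (x + s *\<^sub>R u + h *\<^sub>R v) - D (x + s *\<^sub>R u + 0 *\<^sub>R v) = (h - 0) * DD (x + s *\<^sub>R u + t *\<^sub>R v)"
    using MVT2[of 0 h "\<lambda>t. D (x + s *\<^sub>R u + t *\<^sub>R v)" "\<lambda>t. DD (x + s *\<^sub>R u + t *\<^sub>R v)"] \<open>h > 0\<close>
    by metis
  have "\<phi> h - \<phi> 0 = h * (h * DD (x + s *\<^sub>R u + t *\<^sub>R v))"
    using s(3) t(3) by (simp add: algebra_simps)
  then show ?thesis
    using near[of s t] s t
    by (intro bexI[of _ "x + s *\<^sub>R u + t *\<^sub>R v"])
      (auto simp: \<phi>_def DD_def D_def[abs_def] algebra_simps)
qed

lemma frechet_derivative_commute_real:
  fixes f :: "'a::real_normed_vector \<Rightarrow> real"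
  assumes "open S" and f: "Ck_on 2 S f" and "x \<in> S"
  shows "frechet_derivative (\<lambda>y. frechet_derivative f (at y) u) (at x) v
    = frechet_derivative (\<lambda>y. frechet_derivative f (at y) v) (at x) u"
proof (rule ccontr)
  define A where "A u v p = frechet_derivative (\<lambda>y. frechet_derivative f (at y) u) (at p) v" for u v p
  assume "\<not> ?thesis"
  then have e: "\<bar>A u v x - A v u x\<bar> > 0" (is "?e > 0") by (simp add: A_def)
  have "continuous_on S (A u v)" for u v
    using f by (simp add: numeral_2_eq_2 A_def[abs_def])
  then have "isCont (A u v) x" for u v
    using assms continuous_on_eq_continuous_at by blast
  then have "\<exists>d>0. \<forall>y. dist y x < d \<longrightarrow> dist (A u v y) (A u v x) < c" if "c > 0" for u v c
    using that by (simp add: continuous_at_eps_delta)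
  from this[OF half_gt_zero[OF e], of u v] this[OF half_gt_zero[OF e], of v u]
  obtain d1 d2 where d: "d1 > 0" "d2 > 0"
    "\<And>y. dist y x < d1 \<Longrightarrow> dist (A u v y) (A u v x) < ?e / 2"
    "\<And>y. dist y x < d2 \<Longrightarrow> dist (A v u y) (A v u x) < ?e / 2"
    by metis
  obtain r where r: "r > 0" "cball x r \<subseteq> S" using assms open_contains_cball by blast
  \<comment> \<open>The summand 1 keeps \<open>n\<close> positive when \<open>u\<close> and
    \<open>v\<close> both vanish. The factor 2 in \<open>h\<close> places the parallelogram strictly
    inside the radius where continuity holds the mixed derivatives within half their supposed
    gap.\<close>
  define n where "n = norm u + norm v + 1"
  define h where "h = min r (min d1 d2) / (2 * n)"
  have n: "n \<ge> 1" by (simp add: n_def)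
  have h: "h > 0" using r d n by (simp add: h_def)
  have "h * (norm u + norm v) \<le> h * n" using h by (intro mult_left_mono) (auto simp: n_def)
  also have "h * n = min r (min d1 d2) / 2" using n by (simp add: h_def)
  also have "\<dots> < min r (min d1 d2)" using r d by (simp add: field_simps) (auto simp: min_def)
  finally have small: "h * (norm u + norm v) < min r (min d1 d2)" .
  then have ball: "cball x (h * (norm u + norm v)) \<subseteq> S" "cball x (h * (norm v + norm u)) \<subseteq> S"
    using r by (auto simp: add.commute)
  obtain p q where p: "p \<in> cball x (h * (norm u + norm v))" "q \<in> cball x (h * (norm v + norm u))"
    and "h * (h * A u v p) = f (x + h *\<^sub>R u + h *\<^sub>R v) - f (x + h *\<^sub>R u) - f (x + h *\<^sub>R v) + f x"
      "h * (h * A v u q) = f (x + h *\<^sub>R v + h *\<^sub>R u) - f (x + h *\<^sub>R v) - f (x + h *\<^sub>R u) + f x"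
    using second_difference_mean_value[OF f ball(1) h] second_difference_mean_value[OF f ball(2) h]
    unfolding A_def by metis
  then have "h * (h * A u v p) = h * (h * A v u q)" by (simp add: add_ac)
  then have "A u v p = A v u q" using h by simp
  moreover have "dist (A u v p) (A u v x) < ?e / 2" "dist (A v u q) (A v u x) < ?e / 2"
    using p small d(3)[of p] d(4)[of q] by (auto simp: dist_commute add.commute)
  ultimately show False by (simp add: dist_real_def abs_if split: if_splits)
qed

lemma frechet_derivative_commute:
  fixes f :: "'a::real_normed_vector \<Rightarrow> 'b::euclidean_space"
  assumes "open S" and f: "Ck_on 2 S f" and "x \<in> S"
  shows "frechet_derivative (\<lambda>y. frechet_derivative f (at y) u) (at x) v
    = frechet_derivative (\<lambda>y. frechet_derivative f (at y) v) (at x) u"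
proof (rule euclidean_eqI)
  fix b :: 'b assume "b \<in> Basis"
  have f': "Ck_on (Suc (Suc 0)) S f" using f by (simp add: numeral_2_eq_2)
  have D: "frechet_derivative (\<lambda>y. g y \<bullet> b) (at y) w = frechet_derivative g (at y) w \<bullet> b"
    if "(g has_derivative frechet_derivative g (at y)) (at y)" for g :: "'a \<Rightarrow> 'b" and y w
    using has_derivative_inner_left[OF that, of b] frechet_derivative_at by metis
  have DD: "frechet_derivative (\<lambda>y. frechet_derivative (\<lambda>y. f y \<bullet> b) (at y) w) (at x) z
      = frechet_derivative (\<lambda>y. frechet_derivative f (at y) w) (at x) z \<bullet> b" for w z
  proof -
    have "((\<lambda>y. frechet_derivative f (at y) w \<bullet> b) has_derivative
        (\<lambda>z. frechet_derivative (\<lambda>y. frechet_derivative f (at y) w) (at x) z \<bullet> b)) (at x)"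
      using Ck_on_Suc_has_derivative[OF Ck_on_SucD[OF f'] assms(3)]
      by (rule has_derivative_inner_left)
    then have "((\<lambda>y. frechet_derivative (\<lambda>y. f y \<bullet> b) (at y) w) has_derivative
        (\<lambda>z. frechet_derivative (\<lambda>y. frechet_derivative f (at y) w) (at x) z \<bullet> b)) (at x)"
      by (rule has_derivative_transform_within_open[OF _ assms(1,3)])
        (simp add: D Ck_on_Suc_has_derivative[OF f'])
    then show ?thesis using frechet_derivative_at by metis
  qed
  have "Ck_on 2 S (\<lambda>y. f y \<bullet> b)"
    by (rule Ck_on_bounded_linear[OF assms(1) bounded_linear_inner_left f])
  from frechet_derivative_commute_real[OF assms(1) this assms(3), of u v]
  show "frechet_derivative (\<lambda>y. frechet_derivative f (at y) u) (at x) v \<bullet> b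
    = frechet_derivative (\<lambda>y. frechet_derivative f (at y) v) (at x) u \<bullet> b"
    by (simp add: DD)
qed

subsection \<open>Integration\<close>

lemma integrable_on_compact:
  fixes f :: "'a::euclidean_space \<Rightarrow> real"
  assumes "compact K" and "continuous_on K f"
  shows "f integrable_on K"
  using borel_integrable_compact[OF assms] set_borel_integral_eq_integral(1)[of K f]
  by (simp add: set_integrable_def)

text \<open>On a compact time interval times \<open>K\<close> the time derivative is uniformly
  continuous, so by the mean value theorem the difference quotients converge uniformly on
  \<open>K\<close>. No regularity of the boundary of \<open>K\<close> enters.\<close>

lemma DERIV_integral_compact:
  fixes w w' :: "real \<Rightarrow> 'a::euclidean_space \<Rightarrow> real"
  assumes K: "compact K" and "open U" and "t \<in> U"
    and d: "\<And>s x. s \<in> U \<Longrightarrow> x \<in> K \<Longrightarrow> ((\<lambda>s. w s x) has_real_derivative w' s x) (at s)"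
    and c: "\<And>s. s \<in> U \<Longrightarrow> continuous_on K (w s)"
    and c': "continuous_on (U \<times> K) (\<lambda>(s, x). w' s x)"
  shows "((\<lambda>s. integral K (w s)) has_real_derivative integral K (w' t)) (at t)"
proof -
  obtain r where r: "r > 0" "cball t r \<subseteq> U" using assms(2,3) open_contains_cball by blast
  have uc: "uniformly_continuous_on (cball t r \<times> K) (\<lambda>(s, x). w' s x)"
    using r by (intro compact_uniformly_continuous compact_Times compact_cball K
        continuous_on_subset[OF c']) auto
  have c't: "continuous_on K (w' t)"
  proof -
    have "continuous_on K (\<lambda>x. case (t, x) of (s, x) \<Rightarrow> w' s x)"
      by (rule continuous_on_compose2[OF c' continuous_on_Pair[OF continuous_on_const continuous_on_id]])
        (use assms(3) in auto)
    then show ?thesis by simp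
  qed
  have int: "w s integrable_on K" if "s \<in> U" for s by (rule integrable_on_compact[OF K c[OF that]])
  have int': "w' t integrable_on K" by (rule integrable_on_compact[OF K c't])
  define m where "m = integral K (\<lambda>x. 1 :: real)"
  have int1: "(\<lambda>x. b :: real) integrable_on K" for b by (intro integrable_on_compact K continuous_intros)
  have m: "m \<ge> 0" unfolding m_def by (intro integral_nonneg int1) auto
  show ?thesis
    unfolding DERIV_def
  proof (rule LIM_I)
    fix e :: real assume "e > 0"
    \<comment> \<open>Dividing by \<open>m + 1\<close> rather than by the measure \<open>m\<close>
      also covers sets of measure zero and keeps the final inequality strict.\<close>
    define e' where "e' = e / (m + 1)"
    have e': "e' > 0" using \<open>e > 0\<close> m by (simp add: e'_def)
    obtain d where "d > 0" and unif: "\<And>z y. z \<in> cball t r \<times> K \<Longrightarrow> y \<in> cball t r \<times> K \<Longrightarrow>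
        dist y z < d \<Longrightarrow> dist (case y of (s, x) \<Rightarrow> w' s x) (case z of (s, x) \<Rightarrow> w' s x) < e'"
      using uc e' unfolding uniformly_continuous_on_def by meson
    show "\<exists>d>0. \<forall>h. h \<noteq> 0 \<and> norm (h - 0) < d \<longrightarrow>
      norm ((integral K (w (t + h)) - integral K (w t)) / h - integral K (w' t)) < e"
    proof (intro exI conjI allI impI)
      show "min d r > 0" using \<open>d > 0\<close> r by simp
      fix h :: real assume h: "h \<noteq> 0 \<and> norm (h - 0) < min d r"
      then have hU: "t + h \<in> U" using r by (auto simp: dist_norm subset_iff)
      let ?q = "\<lambda>x. (w (t + h) x - w t x) / h - w' t x"
      have q: "norm (?q x) \<le> e'" if x: "x \<in> K" for x
      proof -
        have near: "s \<in> cball t r" "dist s t < d" if "\<bar>s - t\<bar> \<le> \<bar>h\<bar>" for s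
          using h that by (auto simp: dist_real_def)
        have close: "\<bar>w' s x - w' t x\<bar> < e'" if "\<bar>s - t\<bar> \<le> \<bar>h\<bar>" for s
          using unif[of "(t, x)" "(s, x)"] near[OF that] x r
          by (simp add: dist_Pair_Pair) (simp add: dist_real_def)
        have "\<exists>s. \<bar>s - t\<bar> \<le> \<bar>h\<bar> \<and> w (t + h) x - w t x = h * w' s x"
        proof (cases "h > 0")
          case True
          have "((\<lambda>s. w s x) has_real_derivative w' s x) (at s)" if "t \<le> s" "s \<le> t + h" for s
            using near(1)[of s] that True r x by (intro d) (auto simp: subset_iff)
          then obtain z where "t < z" "z < t + h" "w (t + h) x - w t x = (t + h - t) * w' z x"
            using MVT2[of t "t + h" "\<lambda>s. w s x" "\<lambda>s. w' s x"] True by auto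
          then show ?thesis by (intro exI[of _ z]) auto
        next
          case False
          then have "h < 0" using h by auto
          have "((\<lambda>s. w s x) has_real_derivative w' s x) (at s)" if "t + h \<le> s" "s \<le> t" for s
            using near(1)[of s] that \<open>h < 0\<close> r x by (intro d) (auto simp: subset_iff)
          then obtain z where "t + h < z" "z < t" "w t x - w (t + h) x = (t - (t + h)) * w' z x"
            using MVT2[of "t + h" t "\<lambda>s. w s x" "\<lambda>s. w' s x"] \<open>h < 0\<close> by auto
          then show ?thesis by (intro exI[of _ z]) auto
        qed
        then show ?thesis using close h by force
      qed
      have "integral K ?q = (integral K (w (t + h)) - integral K (w t)) / h - integral K (w' t)"
        using int[OF hU] int[OF assms(3)] int'
        by (simp add: integral_diff integrable_diff integrable_on_divide)
      moreover have "norm (integral K ?q) \<le> integral K (\<lambda>x. e')"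
        using int[OF hU] int[OF assms(3)] int' q
        by (intro integral_norm_bound_integral int1 integrable_diff integrable_on_divide) auto
      moreover have "integral K (\<lambda>x. e') = e' * m"
        using integral_mult_right[of K e' "\<lambda>x. 1 :: real"] by (simp add: m_def)
      moreover have "e' * m < e" using \<open>e > 0\<close> m by (simp add: e'_def field_simps)
      ultimately show "norm ((integral K (w (t + h)) - integral K (w t)) / h - integral K (w' t)) < e"
        by simp
    qed
  qed
qed

text \<open>The difference quotients integrate to \<open>0\<close> by translation invariance.\<close>

lemma has_integral_directional_derivative:
  fixes h h' :: "'a::euclidean_space \<Rightarrow> real"
  assumes K: "compact K" and cont: "continuous_on UNIV h"
    and d: "\<And>x. ((\<lambda>s. h (x + s *\<^sub>R v)) has_real_derivative h' x) (at 0)"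
    and zero: "\<And>x. x \<notin> K \<Longrightarrow> h x = 0" and bd: "\<And>x. \<bar>h' x\<bar> \<le> M"
  shows "(h' has_integral 0) K"
proof -
  have M: "M \<ge> 0" using bd[of undefined] by linarith
  have "(\<lambda>x. indicator K x *\<^sub>R h x) = h" using zero by (auto simp: indicator_def fun_eq_iff)
  then have int_h: "integrable lborel h"
    using borel_integrable_compact[OF K continuous_on_subset[OF cont]] by simp
  have meas_h: "h \<in> borel_measurable borel" using cont by (rule borel_measurable_continuous_onI)
  have shift: "integrable lborel (\<lambda>x. h (x + a))" "(\<integral>x. h (x + a) \<partial>lborel) = (\<integral>x. h x \<partial>lborel)" for a
  proof -
    have "integrable (distr lborel borel ((+) a)) h" using int_h by (simp only: lborel_distr_plus)
    then show "integrable lborel (\<lambda>x. h (x + a))"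
      using meas_h by (subst (asm) integrable_distr_eq) (auto simp: add.commute)
    have "(\<integral>x. h x \<partial>lborel) = (\<integral>x. h x \<partial>distr lborel borel ((+) a))"
      by (simp only: lborel_distr_plus)
    also have "\<dots> = (\<integral>x. h (a + x) \<partial>lborel)"
      using meas_h by (subst integral_distr) auto
    finally show "(\<integral>x. h (x + a) \<partial>lborel) = (\<integral>x. h x \<partial>lborel)" by (simp add: add.commute)
  qed
  define \<epsilon> where "\<epsilon> n = inverse (real (Suc n))" for n
  have \<epsilon>: "0 < \<epsilon> n" "\<epsilon> n \<le> 1" for n by (auto simp: \<epsilon>_def field_simps)
  define q where "q n x = (h (x + \<epsilon> n *\<^sub>R v) - h x) / \<epsilon> n" for n x
  have int_q: "(\<integral>x. q n x \<partial>lborel) = 0" for n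
    unfolding q_def using shift[of "\<epsilon> n *\<^sub>R v"] int_h by (simp add: Bochner_Integration.integral_diff)
  have lim: "(\<lambda>n. q n x) \<longlonglongrightarrow> h' x" for x
  proof -
    have "filterlim \<epsilon> (at 0) sequentially"
      using \<epsilon>(1) unfolding \<epsilon>_def
      by (intro filterlim_atI LIMSEQ_inverse_real_of_nat) (auto simp: less_le)
    moreover have "((\<lambda>e. (h (x + (0 + e) *\<^sub>R v) - h (x + 0 *\<^sub>R v)) / e) \<longlongrightarrow> h' x) (at 0)"
      using d[of x] unfolding DERIV_def .
    ultimately show ?thesis unfolding q_def by (auto dest: filterlim_compose)
  qed
  have meas_q: "q n \<in> borel_measurable lborel" for n
    unfolding q_def using meas_h by measurable
  then have meas_h': "h' \<in> borel_measurable lborel"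
    using lim by (rule borel_measurable_LIMSEQ_real[rotated])
  obtain R where R: "\<And>x. x \<in> K \<Longrightarrow> norm x \<le> R"
    using compact_imp_bounded[OF K] by (auto simp: bounded_iff)
  \<comment> \<open>Translations by \<open>\<epsilon> n *\<^sub>R v\<close> move points by at most
    \<open>norm v\<close>, so every difference quotient vanishes outside this ball; inside it the
    mean value theorem bounds the quotient by \<open>M\<close>. This gives an integrable
    majorant.\<close>
  define B where "B = cball (0::'a) (R + norm v)"
  have bound: "norm (q n x) \<le> M * indicator B x" for n x
  proof (cases "x \<in> B")
    case True
    have "((\<lambda>s. h (x + s *\<^sub>R v)) has_real_derivative h' (x + s *\<^sub>R v)) (at s)" for s
      using d[of "x + s *\<^sub>R v"] DERIV_shift[of "\<lambda>s. h (x + s *\<^sub>R v)" "h' (x + s *\<^sub>R v)" 0 s]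
      by (simp add: algebra_simps)
    then obtain z where "h (x + \<epsilon> n *\<^sub>R v) - h (x + 0 *\<^sub>R v) = (\<epsilon> n - 0) * h' (x + z *\<^sub>R v)"
      using MVT2[OF \<epsilon>(1)[of n], of "\<lambda>s. h (x + s *\<^sub>R v)" "\<lambda>s. h' (x + s *\<^sub>R v)"] by blast
    then have "q n x = h' (x + z *\<^sub>R v)" using \<epsilon>(1)[of n] by (simp add: q_def field_simps)
    then show ?thesis using bd True by simp
  next
    case False
    have "norm (\<epsilon> n *\<^sub>R v) \<le> norm v" using \<epsilon>[of n] by (simp add: mult_left_le_one_le)
    moreover have "norm x > R + norm v" using False by (simp add: B_def)
    moreover have "norm x \<le> norm (x + \<epsilon> n *\<^sub>R v) + norm (\<epsilon> n *\<^sub>R v)"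
      using norm_triangle_ineq4[of "x + \<epsilon> n *\<^sub>R v" "\<epsilon> n *\<^sub>R v"] by simp
    ultimately have "\<not> norm (x + \<epsilon> n *\<^sub>R v) \<le> R" "\<not> norm x \<le> R"
      using norm_ge_zero[of v] by linarith+
    then have "x + \<epsilon> n *\<^sub>R v \<notin> K" "x \<notin> K" using R by auto
    then show ?thesis using zero by (simp add: q_def False)
  qed
  have int_B: "integrable lborel (\<lambda>x. M * indicator B x)"
    unfolding B_def by (intro integrable_mult_right integrable_real_indicator)
      (use emeasure_lborel_cball_finite[of "0::'a" "R + norm v"] in simp_all)
  have "integrable lborel h'"
    by (rule integrable_dominated_convergence[where s=q, OF meas_h' meas_q int_B]) (use lim bound in auto)
  moreover have "(\<lambda>n. \<integral>x. q n x \<partial>lborel) \<longlonglongrightarrow> (\<integral>x. h' x \<partial>lborel)"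
    by (rule integral_dominated_convergence[OF meas_h' meas_q int_B]) (use lim bound in auto)
  then have "(\<integral>x. h' x \<partial>lborel) = 0" by (simp add: int_q LIMSEQ_const_iff)
  ultimately have "(h' has_integral 0) UNIV" using has_integral_integral_lborel by metis
  \<comment> \<open>Off \<open>K\<close> the function is zero in a whole neighbourhood, so its
    derivative vanishes too and the integral over the space is the integral over
    \<open>K\<close>.\<close>
  moreover have "h' x = 0" if "x \<notin> K" for x
  proof -
    have "open (- K)" using K by (simp add: compact_imp_closed open_Compl)
    moreover have "x \<in> - K" using that by simp
    ultimately have "\<forall>\<^sub>F s in nhds 0. x + s *\<^sub>R v \<in> - K"
      using continuous_on_open_vimage[of UNIV "\<lambda>s. x + s *\<^sub>R v"]
      by (intro eventually_nhds[THEN iffD2] exI[of _ "(\<lambda>s. x + s *\<^sub>R v) -` (- K)"])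
        (auto intro!: continuous_intros open_vimage)
    then have "\<forall>\<^sub>F s in nhds 0. h (x + s *\<^sub>R v) = 0"
      by eventually_elim (use zero in auto)
    then have "((\<lambda>s. h (x + s *\<^sub>R v)) has_real_derivative 0) (at 0)"
      by (subst DERIV_cong_ev[OF refl _ refl]) auto
    then show ?thesis using d DERIV_unique by blast
  qed
  then have "(\<lambda>x. if x \<in> K then h' x else 0) = h'" by auto
  ultimately show ?thesis using has_integral_restrict[of K UNIV h' 0] by simp
qed

text \<open>If the second derivative were negative, \<open>g'\<close> would be negative just to the
  right of 0 and the mean value theorem would produce a value below the minimum. Differentiability
  on a neighbourhood is needed before \<open>deriv g\<close> can be identified with
  \<open>g'\<close>.\<close>

lemma second_derivative_at_local_min:
  fixes g g' :: "real \<Rightarrow> real"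
  assumes "r > 0" and g: "\<And>t. \<bar>t\<bar> < r \<Longrightarrow> (g has_real_derivative g' t) (at t)"
    and g': "(g' has_real_derivative l) (at 0)" and min: "\<And>t. \<bar>t\<bar> < r \<Longrightarrow> g 0 \<le> g t"
  shows "deriv (deriv g) 0 \<ge> 0"
proof -
  have "\<forall>\<^sub>F t in nhds 0. \<bar>t\<bar> < r"
    using \<open>r > 0\<close> by (auto simp: eventually_nhds_metric dist_real_def)
  then have "\<forall>\<^sub>F t in nhds 0. deriv g t = g' t"
    by eventually_elim (use g DERIV_imp_deriv in blast)
  then have "(deriv g has_real_derivative l) (at 0)"
    using g' DERIV_cong_ev[OF refl _ refl, of "deriv g" g' 0 l] by blast
  then have l: "deriv (deriv g) 0 = l" by (rule DERIV_imp_deriv)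
  have g0: "g' 0 = 0"
    using DERIV_local_min[OF g[of 0] \<open>r > 0\<close>] min \<open>r > 0\<close> by auto
  have "\<not> l < 0"
  proof
    assume "l < 0"
    then obtain d where d: "d > 0" "\<And>h. 0 < h \<Longrightarrow> h < d \<Longrightarrow> g' (0 + h) < g' 0"
      using DERIV_neg_dec_right[OF g'] by metis
    define t where "t = min d r / 2"
    have t: "0 < t" "t < d" "t < r" using d \<open>r > 0\<close> by (auto simp: t_def)
    obtain z where "0 < z" "z < t" "g t - g 0 = (t - 0) * g' z"
      using MVT2[OF t(1), of g g'] g t by auto
    moreover have "g' z < 0" using d(2)[of z] calculation t g0 by simp
    ultimately have "g t < g 0" using t(1) mult_pos_neg[of t "g' z"] by simp
    then show False using min[of t] t by simp
  qed
  then show ?thesis using l by simp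
qed

text \<open>The change of variables theorem of the library needs a well-ordered index type.\<close>

typedef ('a::finite) well_ordered = "UNIV :: 'a set"
  by simp

instantiation well_ordered :: (finite) "{finite, wellorder}"
begin

definition less_eq_well_ordered :: "'a well_ordered \<Rightarrow> 'a well_ordered \<Rightarrow> bool" where
  "less_eq_well_ordered x y \<longleftrightarrow> to_nat (Rep_well_ordered x) \<le> to_nat (Rep_well_ordered y)"

definition less_well_ordered :: "'a well_ordered \<Rightarrow> 'a well_ordered \<Rightarrow> bool" where
  "less_well_ordered x y \<longleftrightarrow> to_nat (Rep_well_ordered x) < to_nat (Rep_well_ordered y)"

instance
proof
  show "finite (UNIV :: 'a well_ordered set)"
    by (rule finite_imageD[of Rep_well_ordered]) (auto intro: inj_onI simp: Rep_well_ordered_inject)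
next
  fix P :: "'a well_ordered \<Rightarrow> bool" and x
  assume step: "\<And>x. (\<And>y. y < x \<Longrightarrow> P y) \<Longrightarrow> P x"
  show "P x"
    by (induction x rule: measure_induct_rule[of "\<lambda>x. to_nat (Rep_well_ordered x)"])
      (rule step, simp add: less_well_ordered_def)
qed (auto simp: less_eq_well_ordered_def less_well_ordered_def Rep_well_ordered_inject)

end

section \<open>Change of variables over arbitrary finite index types\<close>

definition reindex :: "('b \<Rightarrow> 'a) \<Rightarrow> 'c^'a \<Rightarrow> 'c^'b" where
  "reindex p x = (\<chi> j. x $ p j)"

lemma reindex_inverse:
  assumes "bij p"
  shows "reindex p (reindex (inv p) x) = x" "reindex (inv p) (reindex p y) = y"
  using assms
  by (auto simp: reindex_def vec_eq_iff bij_is_inj bij_is_surj surj_f_inv_f)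

lemma linear_reindex: "linear (reindex p :: real^'a \<Rightarrow> real^'b)"
  by (rule linearI) (auto simp: reindex_def vec_eq_iff)

lemma bounded_linear_reindex: "bounded_linear (reindex p :: real^'a \<Rightarrow> real^'b)"
  using linear_reindex linear_conv_bounded_linear by blast

lemma reindex_cbox:
  fixes u v :: "real^'a" and p :: "'b::finite \<Rightarrow> 'a"
  assumes "bij p"
  shows "reindex p ` cbox u v = cbox (reindex p u) (reindex p v)"
proof
  show "reindex p ` cbox u v \<subseteq> cbox (reindex p u) (reindex p v)"
    by (auto simp: mem_box_cart reindex_def)
  show "cbox (reindex p u) (reindex p v) \<subseteq> reindex p ` cbox u v"
  proof
    fix y assume y: "y \<in> cbox (reindex p u) (reindex p v)"
    have "u $ i \<le> reindex (inv p) y $ i \<and> reindex (inv p) y $ i \<le> v $ i" for i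
    proof -
      have "p (inv p i) = i" using assms by (simp add: bij_is_surj surj_f_inv_f)
      then show ?thesis using y by (auto simp: mem_box_cart reindex_def dest: spec[of _ "inv p i"])
    qed
    then have "reindex (inv p) y \<in> cbox u v" by (simp add: mem_box_cart)
    then show "y \<in> reindex p ` cbox u v"
      using reindex_inverse(1)[OF assms] by (metis imageI)
  qed
qed

lemma content_reindex_cbox:
  fixes u v :: "real^'a" and p :: "'b::finite \<Rightarrow> 'a"
  assumes "bij p"
  shows "measure lborel (reindex p ` cbox u v) = measure lborel (cbox u v)"
proof -
  have "reindex p ` cbox u v = {} \<longleftrightarrow> cbox u v = {}" by simp
  moreover have "(\<Prod>j\<in>UNIV. v $ p j - u $ p j) = (\<Prod>i\<in>UNIV. v $ i - u $ i)"
    by (rule prod.reindex_bij_betw[OF assms])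
  ultimately show ?thesis
    unfolding reindex_cbox[OF assms] content_cbox_if_cart by (simp add: reindex_def)
qed

text \<open>Renaming coordinates sends boxes to boxes of equal content. Boundedness lets
  \<open>S\<close> be placed in one box, with the integrand extended by zero.\<close>

lemma has_integral_reindex:
  fixes f :: "real^'a \<Rightarrow> real" and p :: "'b::finite \<Rightarrow> 'a"
  assumes p: "bij p" and "bounded S" and f: "(f has_integral I) S"
  shows "((\<lambda>y. f (reindex (inv p) y)) has_integral I) (reindex p ` S)"
proof -
  note q = bij_imp_bij_inv[OF p]
  note inverse = reindex_inverse[OF p]
  obtain a where a: "S \<subseteq> cbox (- a) a" using bounded_subset_cbox_symmetric[OF \<open>bounded S\<close>] by blast
  let ?F = "\<lambda>x. if x \<in> S then f x else 0"
  have "(?F has_integral I) (cbox (- a) a)" by (subst has_integral_restrict[OF a]) (rule f)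
  moreover have "\<exists>w z. reindex (inv p) ` cbox u v = cbox w z" for u v :: "real^'b"
    using reindex_cbox[OF q] by blast
  moreover have "\<exists>w z. reindex p ` cbox u v = cbox w z" for u v :: "real^'a"
    using reindex_cbox[OF p] by blast
  ultimately have "((\<lambda>y. ?F (reindex (inv p) y)) has_integral (1 / 1) *\<^sub>R I) (reindex p ` cbox (- a) a)"
    by (intro has_integral_twiddle[of 1])
      (auto simp: inverse content_reindex_cbox[OF q]
        intro: linear_continuous_at[OF bounded_linear_reindex])
  moreover have "reindex (inv p) y \<in> S \<longleftrightarrow> y \<in> reindex p ` S" for y
    by (auto simp: image_iff inverse(2)) (use inverse(1)[of y] in \<open>force\<close>)
  ultimately have "((\<lambda>y. if y \<in> (reindex p :: real^'a \<Rightarrow> real^'b) ` S then f (reindex (inv p) y) else 0) has_integral I)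
      (reindex p ` cbox (- a) a)"
    by simp
  moreover have "reindex p ` S \<subseteq> reindex p ` cbox (- a) a" using a by blast
  ultimately show ?thesis by (simp only: has_integral_restrict)
qed

text \<open>Conjugation by \<open>p\<close> is a sign-preserving bijection between the permutations
  of the two index types, so the Leibniz sums agree term by term.\<close>

lemma det_reindex:
  fixes A :: "real^'a^'a" and p :: "'b::finite \<Rightarrow> 'a"
  assumes p: "bij p"
  shows "det (\<chi> i j. A $ p i $ p j) = det A"
proof -
  let ?P = "{q. q permutes (UNIV :: 'a set)}" and ?Q = "{q. q permutes (UNIV :: 'b set)}"
  let ?m = "map_permutation UNIV p" and ?l = "map_permutation UNIV (inv p)"
  have inj: "inj p" "inj (inv p)" using p by (auto simp: bij_is_inj bij_imp_bij_inv)
  have "bij_betw ?m ?Q ?P"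
  proof (rule bij_betwI[where g = ?l])
    show "?m \<in> ?Q \<rightarrow> ?P" using map_permutation_permutes[OF p] by auto
    show "?l \<in> ?P \<rightarrow> ?Q" using map_permutation_permutes[OF bij_imp_bij_inv[OF p]] by auto
    show "?l (?m q) = q" if "q \<in> ?Q" for q
      using that p by (intro map_permutation_compose_inv) (auto simp: bij_is_inj)
    show "?m (?l q) = q" if "q \<in> ?P" for q
      using that p by (intro map_permutation_compose_inv bij_imp_bij_inv)
        (auto simp: bij_is_surj surj_f_inv_f)
  qed
  then have "det A = (\<Sum>q\<in>?Q. of_int (sign (?m q)) * (\<Prod>i\<in>UNIV. A $ i $ ?m q i))"
    unfolding det_def by (rule sum.reindex_bij_betw[symmetric])
  also have "\<dots> = det (\<chi> i j. A $ p i $ p j)"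
    unfolding det_def
  proof (rule sum.cong[OF refl])
    fix q assume q: "q \<in> ?Q"
    have "(\<Prod>i\<in>UNIV. A $ i $ ?m q i) = (\<Prod>j\<in>UNIV. A $ p j $ ?m q (p j))"
      by (rule prod.reindex_bij_betw[OF p, symmetric])
    also have "\<dots> = (\<Prod>j\<in>UNIV. A $ p j $ p (q j))"
      by (simp add: map_permutation_apply inj)
    finally show "of_int (sign (?m q)) * (\<Prod>i\<in>UNIV. A $ i $ ?m q i)
        = of_int (sign q) * (\<Prod>i\<in>UNIV. (\<chi> i j. A $ p i $ p j) $ i $ q i)"
      using q inj by (simp add: sign_map_permutation)
  qed
  finally show ?thesis by simp
qed

text \<open>Nonnegativity upgrades integrability of the weighted integrand to the absolute
  integrability that the change of variables needs; \<open>vec\<close> passes to values in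
  \<open>real^1\<close>.\<close>

lemma change_of_variables_nonneg_well_ordered:
  fixes g :: "real^'a::{finite,wellorder} \<Rightarrow> real^'a::_" and \<phi> :: "real^'a::_ \<Rightarrow> real"
  assumes "compact S" and "\<And>x. x \<in> S \<Longrightarrow> (g has_derivative g' x) (at x within S)" and "inj_on g S"
    and nonneg: "\<And>y. y \<in> g ` S \<Longrightarrow> \<phi> y \<ge> 0"
    and int: "((\<lambda>x. \<bar>det (matrix (g' x))\<bar> * \<phi> (g x)) has_integral I) S"
  shows "(\<phi> has_integral I) (g ` S)"
proof -
  let ?w = "\<lambda>x. \<bar>det (matrix (g' x))\<bar> * \<phi> (g x)"
  have "?w absolutely_integrable_on S"
    using int nonneg by (intro nonnegative_absolutely_integrable_1) (auto simp: has_integral_iff)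
  then have "(\<lambda>x. vec (?w x) :: real^1) absolutely_integrable_on S"
    by (simp add: absolutely_integrable_on_1_iff)
  moreover have "(\<lambda>x. vec (?w x) :: real^1) = (\<lambda>x. \<bar>det (matrix (g' x))\<bar> *\<^sub>R vec (\<phi> (g x)))"
    by (simp add: vec_eq_iff fun_eq_iff)
  moreover have "integral S (\<lambda>x. vec (?w x) :: real^1) = vec I"
    using int by (simp add: has_integral_iff integral_on_1_eq)
  ultimately have "(\<lambda>y. vec (\<phi> y) :: real^1) absolutely_integrable_on g ` S \<and>
      integral (g ` S) (\<lambda>y. vec (\<phi> y) :: real^1) = vec I"
    using has_absolute_integral_change_of_variables_compact[OF assms(1-3), of "\<lambda>y. vec (\<phi> y) :: real^1" "vec I"]
    by simp
  then show ?thesis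
    by (auto simp: has_integral_iff integral_on_1_eq absolutely_integrable_on_1_iff vec_eq_iff
        set_lebesgue_integral_eq_integral(1))
qed

text \<open>The map is conjugated by the renaming \<open>e\<close> of coordinates. This leaves the
  Jacobian determinant unchanged, and integrals are carried over and back by
  \<open>has_integral_reindex\<close>.\<close>

lemma change_of_variables_nonneg:
  fixes g :: "real^'a \<Rightarrow> real^'a" and \<phi> :: "real^'a \<Rightarrow> real"
  assumes S: "compact S" and der: "\<And>x. x \<in> S \<Longrightarrow> (g has_derivative g' x) (at x within S)"
    and "inj_on g S" and nonneg: "\<And>y. y \<in> g ` S \<Longrightarrow> \<phi> y \<ge> 0"
    and int: "((\<lambda>x. \<bar>det (matrix (g' x))\<bar> * \<phi> (g x)) has_integral I) S"
  shows "(\<phi> has_integral I) (g ` S)"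
proof -
  define p :: "'a well_ordered \<Rightarrow> 'a" where "p = Rep_well_ordered"
  have p: "bij p"
    unfolding p_def
    by (metis Abs_well_ordered_inverse Rep_well_ordered_inject UNIV_I bijI injI surjI)
  define e where "e = (reindex p :: real^'a \<Rightarrow> real^'a well_ordered)"
  define e' where "e' = (reindex (inv p) :: real^'a well_ordered \<Rightarrow> real^'a)"
  have e: "e (e' y) = y" "e' (e x) = x" for x y
    using reindex_inverse[OF p] by (auto simp: e_def e'_def)
  have bl: "bounded_linear e" "bounded_linear e'"
    by (simp_all add: e_def e'_def bounded_linear_reindex)
  define h where "h = (\<lambda>y. e (g (e' y)))"
  define h' where "h' = (\<lambda>y v. e (g' (e' y) (e' v)))"
  have eS: "e' ` e ` S = S" by (simp add: image_image e)
  have hS: "h ` e ` S = e ` g ` S" by (simp add: image_image h_def e)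
  have "compact (e ` S)"
    using S bl by (intro compact_continuous_image linear_continuous_on)
  moreover have "(h has_derivative h' y) (at y within e ` S)" if y: "y \<in> e ` S" for y
  proof -
    have "(g has_derivative g' (e' y)) (at (e' y) within e' ` e ` S)"
      using y der by (auto simp: eS e)
    then have "((\<lambda>y. g (e' y)) has_derivative (\<lambda>v. g' (e' y) (e' v))) (at y within e ` S)"
      by (rule has_derivative_in_compose[OF bounded_linear_imp_has_derivative[OF bl(2)]])
    then show ?thesis
      unfolding h_def h'_def by (rule bounded_linear.has_derivative[OF bl(1)])
  qed
  moreover have "inj_on h (e ` S)"
  proof (rule inj_onI)
    fix y z assume "y \<in> e ` S" "z \<in> e ` S" and eq: "h y = h z"
    then obtain a b where ab: "a \<in> S" "b \<in> S" "y = e a" "z = e b" by blast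
    have "g a = g b" using eq e ab by (metis h_def)
    then show "y = z" using \<open>inj_on g S\<close> ab by (auto dest: inj_onD)
  qed
  moreover have "\<phi> (e' y) \<ge> 0" if "y \<in> h ` e ` S" for y
    using that nonneg by (auto simp: hS e)
  moreover have "((\<lambda>y. \<bar>det (matrix (h' y))\<bar> * \<phi> (e' (h y))) has_integral I) (e ` S)"
  proof -
    have "det (matrix (h' y)) = det (matrix (g' (e' y)))" for y
    proof -
      have "e' (axis j 1) = axis (p j) 1" for j
        using p by (auto simp: e'_def reindex_def vec_eq_iff axis_def bij_is_surj surj_f_inv_f bij_is_inj)
      then have "matrix (h' y) = (\<chi> i j. matrix (g' (e' y)) $ p i $ p j)"
        by (simp add: matrix_def h'_def) (simp add: e_def reindex_def vec_eq_iff)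
      then show ?thesis using det_reindex[OF p] by metis
    qed
    moreover have "((\<lambda>y. \<bar>det (matrix (g' (e' y)))\<bar> * \<phi> (g (e' y))) has_integral I) (e ` S)"
      unfolding e_def e'_def by (rule has_integral_reindex[OF p compact_imp_bounded[OF S] int])
    ultimately show ?thesis by (simp add: h_def e)
  qed
  ultimately have *: "((\<lambda>y. \<phi> (e' y)) has_integral I) (h ` e ` S)"
    by (rule change_of_variables_nonneg_well_ordered)
  have "bounded (e ` g ` S)"
    by (intro compact_imp_bounded compact_continuous_image S linear_continuous_on bl
        has_derivative_continuous_on[OF der])
  then have "((\<lambda>x. \<phi> (e' (reindex (inv (inv p)) x))) has_integral I) (e' ` (e ` g ` S))"
    using * unfolding hS e'_def by (rule has_integral_reindex[OF bij_imp_bij_inv[OF p]])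
  moreover have "reindex (inv (inv p)) = e" using p by (simp add: e_def inv_inv_eq)
  ultimately show ?thesis by (simp add: image_image e)
qed

subsection \<open>Minimal immersions\<close>

lemma Ck_on_matrix_inv:
  fixes G :: "'a::real_normed_vector \<Rightarrow> real^'n^'n"
  assumes "open S" and G: "\<And>i j. Ck_on k S (\<lambda>x. G x $ i $ j)" and nz: "\<And>x. x \<in> S \<Longrightarrow> det (G x) \<noteq> 0"
  shows "Ck_on k S (\<lambda>x. matrix_inv (G x) $ i $ j)"
proof -
  have "Ck_on k S (\<lambda>x. (\<chi> p q. if q = i then axis j 1 $ p else G x $ p $ q) $ p $ q)" for p q
    using G by (cases "q = i") (simp_all add: Ck_on_const)
  then have "Ck_on k S (\<lambda>x. det (\<chi> p q. if q = i then axis j 1 $ p else G x $ p $ q) * inverse (det (G x)))"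
    by (intro Ck_on_mult Ck_on_det Ck_on_inverse assms)
  then show ?thesis
    by (rule Ck_on_cong[OF assms(1), rotated]) (simp add: matrix_inv_cramer nz divide_inverse)
qed

section \<open>Coordinate derivatives and the induced metric\<close>

lemma Ck_on_partial_d: "Ck_on (Suc k) D F \<Longrightarrow> Ck_on k D (partial_d i F)"
  by (simp add: partial_d_def[abs_def])

lemma Ck_on_induced_metric:
  assumes "open D" and "Ck_on (Suc k) D F"
  shows "Ck_on k D (\<lambda>x. induced_metric F x $ i $ j)"
  unfolding induced_metric_def using assms by (simp add: Ck_on_inner Ck_on_partial_d)

lemma partial_d_eq: "(f has_derivative f') (at x) \<Longrightarrow> partial_d i f x = f' (axis i 1)"
  unfolding partial_d_def using frechet_derivative_at by metis

lemma partial_d_commute: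
  assumes "open D" and "Ck_on 2 D F" and "x \<in> D"
  shows "partial_d i (partial_d j F) x = partial_d j (partial_d i F) x"
  using frechet_derivative_commute[OF assms] by (simp add: partial_d_def[abs_def])

lemma has_real_derivative_partial_d:
  fixes f :: "real^'n \<Rightarrow> real"
  assumes "f differentiable (at x)"
  shows "((\<lambda>s. f (x + s *\<^sub>R axis i 1)) has_real_derivative partial_d i f x) (at 0)"
  using has_vector_derivative_line[of f x 0 "axis i 1"] assms
  by (simp add: partial_d_def has_real_derivative_iff_has_vector_derivative)

lemma partial_d_scaleR:
  assumes "u differentiable (at x)" and "v differentiable (at x)"
  shows "partial_d i (\<lambda>y. u y *\<^sub>R v y) x = u x *\<^sub>R partial_d i v x + partial_d i u x *\<^sub>R v x"
proof -
  note D = assms[unfolded frechet_derivative_works]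
  show ?thesis
    using partial_d_eq[OF has_derivative_scaleR[OF D]] by (simp add: partial_d_def)
qed

lemma partial_d_mult:
  fixes u v :: "real^'n \<Rightarrow> real"
  assumes "u differentiable (at x)" and "v differentiable (at x)"
  shows "partial_d i (\<lambda>y. u y * v y) x = u x * partial_d i v x + partial_d i u x * v x"
  using partial_d_scaleR[OF assms] by simp

lemma partial_d_inner:
  assumes "u differentiable (at x)" and "v differentiable (at x)"
  shows "partial_d i (\<lambda>y. u y \<bullet> v y) x = u x \<bullet> partial_d i v x + partial_d i u x \<bullet> v x"
proof -
  note D = assms[unfolded frechet_derivative_works]
  show ?thesis
    using partial_d_eq[OF has_derivative_inner[OF D]] by (simp add: partial_d_def)
qed

lemma partial_d_sum:
  assumes "\<And>j. j \<in> I \<Longrightarrow> u j differentiable (at x)"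
  shows "partial_d i (\<lambda>y. \<Sum>j\<in>I. u j y) x = (\<Sum>j\<in>I. partial_d i (u j) x)"
proof -
  note D = assms[unfolded frechet_derivative_works]
  show ?thesis
    using partial_d_eq[OF has_derivative_sum[OF D]] by (simp add: partial_d_def)
qed

lemma partial_d_cong:
  assumes "open D" and "x \<in> D" and "\<And>y. y \<in> D \<Longrightarrow> f y = g y" and "f differentiable (at x)"
  shows "partial_d i f x = partial_d i g x"
proof -
  have "(g has_derivative frechet_derivative f (at x)) (at x)"
    using has_derivative_transform_within_open[OF _ assms(1,2)] assms(3,4) frechet_derivative_works
    by blast
  then show ?thesis unfolding partial_d_def using frechet_derivative_at by metis
qed

text \<open>The divergence of \<open>weighted_gradient F\<close> is the Laplace-Beltrami operator of the induced metric
  applied to the coordinates of \<open>F\<close>, times the volume density.\<close>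

definition weighted_gradient :: "(real^'n \<Rightarrow> 'a::euclidean_space) \<Rightarrow> 'n \<Rightarrow> real^'n \<Rightarrow> 'a" where
  "weighted_gradient F i x = (\<Sum>j\<in>UNIV.
     (sqrt (det (induced_metric F x)) * matrix_inv (induced_metric F x) $ i $ j) *\<^sub>R partial_d j F x)"

text \<open>For an immersion, the Laplacian of the position vector is the mean curvature vector. In
  arbitrary coordinates the terms with derivatives of the coefficients are tangential, so they
  cannot spoil the normal part; the tangential part cancels by symmetry of the second
  derivatives.\<close>

lemma weighted_gradient_divergence_free:
  fixes F :: "real^'n \<Rightarrow> 'a::euclidean_space"
  assumes D: "open D" and F: "Ck_on 2 D F" and min: "minimal_on D F"
    and pos: "\<And>x. x \<in> D \<Longrightarrow> det (induced_metric F x) > 0" and x: "x \<in> D"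
  shows "(\<Sum>i\<in>UNIV. partial_d i (weighted_gradient F i) x) = 0"
proof -
  have F': "Ck_on (Suc (Suc 0)) D F" using F by (simp add: numeral_2_eq_2)
  define w where "w y = sqrt (det (induced_metric F y))" for y
  define G where "G y = matrix_inv (induced_metric F y)" for y
  define a where "a i j y = w y * G y $ i $ j" for i j y
  define FF where "FF i j = partial_d i (partial_d j F) x" for i j
  have FF_sym: "FF i j = FF j i" for i j
    unfolding FF_def by (rule partial_d_commute[OF D F x])
  have inv: "invertible (induced_metric F y)" if "y \<in> D" for y
    using pos[OF that] invertible_det_nz by (metis less_irrefl)
  have gij: "induced_metric F y $ i $ j = partial_d i F y \<bullet> partial_d j F y" for y i j
    by (simp add: induced_metric_def)
  have "transpose (induced_metric F x) = induced_metric F x"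
    by (simp add: transpose_def vec_eq_iff gij inner_commute)
  then have "transpose (G x) = G x"
    unfolding G_def by (rule transpose_matrix_inv_symmetric[OF inv[OF x]])
  then have G_sym: "G x $ i $ j = G x $ j $ i" for i j
    by (metis transpose_def vec_lambda_beta)
  have C1: "Ck_on (Suc 0) D (\<lambda>y. induced_metric F y $ i $ j)" "Ck_on (Suc 0) D w"
    "Ck_on (Suc 0) D (a i j)" "Ck_on (Suc 0) D (partial_d i F)" for i j
    using pos unfolding a_def w_def G_def
    by (auto intro!: Ck_on_mult Ck_on_sqrt Ck_on_det Ck_on_matrix_inv Ck_on_induced_metric D F'
        Ck_on_partial_d simp del: Ck_on.simps dest: less_imp_neq[THEN not_sym])
  then have diff: "(\<lambda>y. induced_metric F y $ i $ j) differentiable (at x)" "w differentiable (at x)"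
    "a i j differentiable (at x)" "partial_d i F differentiable (at x)" for i j
    using x by simp_all
  have dg: "partial_d k (\<lambda>y. induced_metric F y $ i $ j) x
      = partial_d i F x \<bullet> FF k j + FF k i \<bullet> partial_d j F x" for i j k
    unfolding gij FF_def by (rule partial_d_inner[OF diff(4) diff(4)])
  define Z where "Z = (\<Sum>i\<in>UNIV. \<Sum>j\<in>UNIV. a i j x *\<^sub>R FF i j + partial_d i (a i j) x *\<^sub>R partial_d j F x)"
  have Z: "(\<Sum>i\<in>UNIV. partial_d i (weighted_gradient F i) x) = Z"
  proof -
    have "weighted_gradient F i = (\<lambda>y. \<Sum>j\<in>UNIV. a i j y *\<^sub>R partial_d j F y)" for i
      by (simp add: weighted_gradient_def a_def w_def G_def fun_eq_iff)
    moreover have "partial_d i (\<lambda>y. \<Sum>j\<in>UNIV. a i j y *\<^sub>R partial_d j F y) x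
        = (\<Sum>j\<in>UNIV. a i j x *\<^sub>R FF i j + partial_d i (a i j) x *\<^sub>R partial_d j F x)" for i
      unfolding FF_def
      by (subst partial_d_sum)
        (auto intro!: differentiable_scaleR diff sum.cong partial_d_scaleR)
    ultimately show ?thesis by (simp add: Z_def)
  qed
  \<comment> \<open>Minimality makes \<open>Z\<close> tangential, while its tangential part always vanishes.\<close>
  let ?T = "span (range (\<lambda>k. partial_d k F x))"
  have tangential: "partial_d k F x \<in> ?T" for k by (intro span_base) simp
  have "Z \<in> ?T"
  proof -
    have "normal_part F x v - v \<in> ?T" for v
      unfolding normal_part_def by (auto intro!: span_neg span_sum span_scale tangential)
    then have "(\<Sum>i\<in>UNIV. \<Sum>j\<in>UNIV. G x $ i $ j *\<^sub>R (normal_part F x (FF i j) - FF i j)) \<in> ?T"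
      by (intro span_sum span_scale)
    moreover have "(\<Sum>i\<in>UNIV. \<Sum>j\<in>UNIV. G x $ i $ j *\<^sub>R normal_part F x (FF i j)) = 0"
      using min x by (simp add: minimal_on_def mean_curvature_def second_fundamental_form_def G_def FF_def)
    ultimately have "- (\<Sum>i\<in>UNIV. \<Sum>j\<in>UNIV. G x $ i $ j *\<^sub>R FF i j) \<in> ?T"
      by (simp add: scaleR_diff_right sum_subtractf)
    then have "w x *\<^sub>R (\<Sum>i\<in>UNIV. \<Sum>j\<in>UNIV. G x $ i $ j *\<^sub>R FF i j) \<in> ?T"
      using span_neg span_scale by fastforce
    then have "(\<Sum>i\<in>UNIV. \<Sum>j\<in>UNIV. a i j x *\<^sub>R FF i j) \<in> ?T"
      by (simp add: a_def scaleR_sum_right)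
    moreover have "(\<Sum>i\<in>UNIV. \<Sum>j\<in>UNIV. partial_d i (a i j) x *\<^sub>R partial_d j F x) \<in> ?T"
      by (intro span_sum span_scale tangential)
    ultimately show ?thesis unfolding Z_def by (simp add: sum.distrib span_add)
  qed
  moreover have "Z \<bullet> partial_d k F x = 0" for k
  proof -
    \<comment> \<open>Jacobi's formula gives half the trace of the inverse metric against the
      derivative of the metric. The product rule splits that derivative into two terms which
      contribute equally by symmetry of the metric, and this removes the factor 1/2.\<close>
    have dw: "partial_d k w x = (\<Sum>i\<in>UNIV. \<Sum>j\<in>UNIV. a i j x * (FF k i \<bullet> partial_d j F x))"
    proof -
      define g' where "g' = (\<chi> i j. partial_d k (\<lambda>y. induced_metric F y $ i $ j) x)"
      have "((\<lambda>s. induced_metric F (x + s *\<^sub>R axis k 1) $ i $ j) has_real_derivative g' $ i $ j) (at 0)" for i j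
        using has_real_derivative_partial_d[OF diff(1)] by (simp add: g'_def)
      then have "((\<lambda>s. det (induced_metric F (x + s *\<^sub>R axis k 1))) has_real_derivative
          det (induced_metric F x) * trace (G x ** g')) (at 0)"
        using has_real_derivative_det[of "\<lambda>s. induced_metric F (x + s *\<^sub>R axis k 1)" g' 0] inv[OF x]
        by (simp add: G_def)
      then have "((\<lambda>s. w (x + s *\<^sub>R axis k 1)) has_real_derivative
          det (induced_metric F x) * trace (G x ** g') * (inverse (w x) / 2)) (at 0)"
        unfolding w_def using pos[OF x]
        by (auto intro!: derivative_eq_intros)
      moreover have "((\<lambda>s. w (x + s *\<^sub>R axis k 1)) has_real_derivative partial_d k w x) (at 0)"
        by (rule has_real_derivative_partial_d[OF diff(2)])
      ultimately have "partial_d k w x = det (induced_metric F x) * trace (G x ** g') * (inverse (w x) / 2)"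
        by (rule DERIV_unique[rotated])
      also have "det (induced_metric F x) = w x * w x" using pos[OF x] by (simp add: w_def)
      also have "w x * w x * trace (G x ** g') * (inverse (w x) / 2) = w x * trace (G x ** g') / 2"
      proof -
        have "w x > 0" using pos[OF x] by (simp add: w_def)
        then show ?thesis by simp
      qed
      also have "w x * trace (G x ** g') = (\<Sum>i\<in>UNIV. \<Sum>j\<in>UNIV. a i j x * g' $ j $ i)"
        by (simp add: trace_def matrix_matrix_mult_def sum_distrib_left a_def mult.assoc)
      also have "\<dots> = (\<Sum>i\<in>UNIV. \<Sum>j\<in>UNIV. a i j x * (FF k i \<bullet> partial_d j F x))
          + (\<Sum>i\<in>UNIV. \<Sum>j\<in>UNIV. a j i x * (FF k j \<bullet> partial_d i F x))"
        by (simp add: g'_def dg distrib_left sum.distrib inner_commute a_def G_sym)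
      also have "(\<Sum>i\<in>UNIV. \<Sum>j\<in>UNIV. a j i x * (FF k j \<bullet> partial_d i F x))
          = (\<Sum>i\<in>UNIV. \<Sum>j\<in>UNIV. a i j x * (FF k i \<bullet> partial_d j F x))"
        by (rule sum.swap)
      finally show ?thesis by simp
    qed
    \<comment> \<open>Differentiating the identity that \<open>a\<close> times the metric is
      \<open>w\<close> times the identity matrix avoids any formula for the derivative of the
      inverse metric.\<close>
    have row: "(\<Sum>j\<in>UNIV. a i j x * partial_d i (\<lambda>y. induced_metric F y $ j $ k) x
        + partial_d i (a i j) x * induced_metric F x $ j $ k) = (if i = k then partial_d k w x else 0)" for i
    proof -
      have eq: "(\<Sum>j\<in>UNIV. a i j y * induced_metric F y $ j $ k) = (if i = k then w y else 0)"
        if "y \<in> D" for y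
      proof -
        have "(\<Sum>j\<in>UNIV. G y $ i $ j * induced_metric F y $ j $ k) = (if i = k then 1 else 0)"
          using arg_cong[OF matrix_inv_left[OF inv[OF that]], of "\<lambda>A. A $ i $ k"]
          by (simp add: matrix_matrix_mult_def mat_def G_def)
        then show ?thesis
          by (simp add: a_def mult.assoc sum_distrib_left[symmetric])
      qed
      have "partial_d i (\<lambda>y. \<Sum>j\<in>UNIV. a i j y * induced_metric F y $ j $ k) x
          = partial_d i (\<lambda>y. if i = k then w y else 0) x"
        by (rule partial_d_cong[OF D x]) (auto simp: eq intro!: differentiable_sum differentiable_mult diff)
      moreover have "partial_d i (\<lambda>y. \<Sum>j\<in>UNIV. a i j y * induced_metric F y $ j $ k) x
          = (\<Sum>j\<in>UNIV. a i j x * partial_d i (\<lambda>y. induced_metric F y $ j $ k) x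
            + partial_d i (a i j) x * induced_metric F x $ j $ k)"
        by (subst partial_d_sum) (auto intro!: differentiable_mult diff sum.cong partial_d_mult)
      moreover have "partial_d i (\<lambda>y. if i = k then w y else 0) x = (if i = k then partial_d k w x else 0)"
        by (simp add: partial_d_eq[OF has_derivative_const])
      ultimately show ?thesis by simp
    qed
    have "Z \<bullet> partial_d k F x = (\<Sum>i\<in>UNIV. \<Sum>j\<in>UNIV. a i j x * (FF i j \<bullet> partial_d k F x)
        + partial_d i (a i j) x * induced_metric F x $ j $ k)"
      by (simp add: Z_def inner_sum_left inner_add_left gij)
    \<comment> \<open>The product rule for the metric rewrites
      \<open>FF i j \<bullet> partial_d k F x\<close> as the derivative of a metric coefficient
      minus \<open>FF k i \<bullet> partial_d j F x\<close>. The first kind of term is summed by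
      \<open>row\<close>, the second by \<open>dw\<close>, and both give
      \<open>partial_d k w x\<close>.\<close>
    also have "\<dots> = (\<Sum>i\<in>UNIV. \<Sum>j\<in>UNIV. (a i j x * partial_d i (\<lambda>y. induced_metric F y $ j $ k) x
        + partial_d i (a i j) x * induced_metric F x $ j $ k)
        - a i j x * (FF k i \<bullet> partial_d j F x))"
      by (intro sum.cong refl) (simp add: dg FF_sym[of k] inner_commute algebra_simps)
    also have "\<dots> = (\<Sum>i\<in>UNIV. if i = k then partial_d k w x else 0) - partial_d k w x"
      by (simp only: sum_subtractf row dw)
    also have "\<dots> = 0" by simp
    finally show ?thesis .
  qed
  ultimately have "Z \<bullet> Z = 0"
    using orthogonal_to_span[of Z "range (\<lambda>k. partial_d k F x)" Z] by (auto simp: orthogonal_def)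
  then show ?thesis by (simp add: Z)
qed

subsection \<open>Comparison of minimal graphs with nearby parametrized surfaces\<close>

lemma Ck_on_ident:
  assumes "open S"
  shows "Ck_on k S (\<lambda>x. x)"
proof (cases k)
  case (Suc l)
  show ?thesis unfolding Suc by (rule Ck_on_SucI[OF assms has_derivative_ident Ck_on_const])
qed simp

lemma Ck_on_graph_param:
  fixes f :: "'a::real_normed_vector \<Rightarrow> 'b::real_normed_vector"
  assumes "open D" and "Ck_on k D f"
  shows "Ck_on k D (graph_param f)"
proof -
  have "Ck_on k D (\<lambda>x. (x, 0 :: 'b) + (0 :: 'a, f x))"
    by (intro Ck_on_add Ck_on_bounded_linear[where L="\<lambda>x. (x, 0)"]
        Ck_on_bounded_linear[where L="\<lambda>y. (0, y)"] assms Ck_on_ident bounded_linear_Pair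
        bounded_linear_ident bounded_linear_zero)
  then show ?thesis by (simp add: graph_param_def[abs_def])
qed

lemma has_derivative_graph_param:
  assumes "(f has_derivative f') (at x)"
  shows "(graph_param f has_derivative (\<lambda>v. (v, f' v))) (at x)"
  unfolding graph_param_def[abs_def] using assms by (intro has_derivative_Pair has_derivative_ident)

lemma induced_metric_eq:
  fixes F :: "real^'n \<Rightarrow> (real^'n) \<times> (real^'m)"
  assumes "(F has_derivative F') (at x)"
  defines "A \<equiv> matrix (\<lambda>v. fst (F' v))" and "B \<equiv> matrix (\<lambda>v. snd (F' v))"
  shows "induced_metric F x = transpose A ** A + transpose B ** B"
  by (simp add: induced_metric_def partial_d_eq[OF assms(1)] vec_eq_iff matrix_matrix_mult_def
      transpose_def A_def B_def matrix_def inner_prod_def inner_vec_def)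

lemma induced_metric_graph_param:
  fixes f :: "real^'n \<Rightarrow> real^'m"
  assumes "(f has_derivative f') (at x)"
  shows "induced_metric (graph_param f) x = gram (matrix f')"
  using induced_metric_eq[OF has_derivative_graph_param[OF assms]]
  by (simp add: gram_def matrix_id_mat_1[unfolded id_def] transpose_mat)

lemma Ck_on_weighted_gradient:
  assumes D: "open D" and F: "Ck_on (Suc k) D F"
    and pos: "\<And>x. x \<in> D \<Longrightarrow> det (induced_metric F x) > 0"
  shows "Ck_on k D (weighted_gradient F i)"
proof -
  have "det (induced_metric F x) \<noteq> 0" if "x \<in> D" for x using pos[OF that] by simp
  then show ?thesis
    unfolding weighted_gradient_def[abs_def]
    by (intro Ck_on_sum Ck_on_scaleR Ck_on_mult Ck_on_sqrt Ck_on_det Ck_on_matrix_inv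
        Ck_on_induced_metric Ck_on_partial_d D F pos)
qed

lemma continuous_on_sqrt_det_induced_metric:
  assumes "open D" and "Ck_on (Suc 0) D F" and "K \<subseteq> D"
  shows "continuous_on K (\<lambda>x. sqrt (det (induced_metric F x)))"
  using Ck_on_det[OF assms(1) Ck_on_induced_metric[OF assms(1,2)]] assms(3)
  by (auto intro: continuous_on_real_sqrt continuous_on_subset)

text \<open>Write \<open>g x = x + u x\<close> with \<open>u\<close> Lipschitz of constant 1/2. The
  triangle inequality gives the expansion estimate and hence injectivity; surjectivity is the Banach
  fixed point of \<open>y - u x\<close>.\<close>

lemma near_identity_bij:
  fixes g :: "'a::euclidean_space \<Rightarrow> 'a"
  assumes g: "\<And>x. (g has_derivative g' x) (at x)"
    and close: "\<And>x v. norm (g' x v - v) \<le> norm v / 2"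
  shows "bij g" and "\<And>x y. norm (x - y) \<le> 2 * norm (g x - g y)"
proof -
  define u where "u x = g x - x" for x
  have du: "(u has_derivative (\<lambda>v. g' x v - v)) (at x)" for x
    unfolding u_def[abs_def] by (intro has_derivative_diff g has_derivative_ident)
  have "onorm (\<lambda>v. g' x v - v) \<le> 1 / 2" for x
    by (rule onorm_bound) (use close in auto)
  then have u: "norm (u x - u y) \<le> 1 / 2 * norm (x - y)" for x y
    using differentiable_bound[of UNIV u "\<lambda>x v. g' x v - v" "1/2" x y] du by auto
  show expand: "norm (x - y) \<le> 2 * norm (g x - g y)" for x y
  proof -
    have "x - y = (g x - g y) - (u x - u y)" by (simp add: u_def)
    then have "norm (x - y) \<le> norm (g x - g y) + norm (u x - u y)"
      by (metis norm_triangle_ineq4)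
    then show ?thesis using u[of x y] by linarith
  qed
  have "inj g" using expand by (intro injI) (metis cancel_comm_monoid_add_class.diff_cancel
      mult_zero_right norm_le_zero_iff norm_zero right_minus_eq)
  moreover have "\<exists>x. g x = y" for y
  proof -
    have "\<exists>!x. y - u x = x"
      by (rule banach_fix_type[of "1/2"])
        (use u in \<open>auto simp: dist_norm norm_minus_commute\<close>)
    then obtain x where "y - u x = x" by blast
    then have "g x = y" by (simp add: u_def algebra_simps)
    then show ?thesis by blast
  qed
  then have "surj g" by (metis surjI)
  ultimately show "bij g" by (simp add: bij_def)
qed

text \<open>Closeness of the horizontal derivative to the identity makes the surface a
  reparametrized graph. The bound of the vertical by the horizontal derivative says that the new
  graph map is still length-nonincreasing, because its derivative is the vertical derivative
  composed with the inverse of the horizontal one. Then the tangent inequality can be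
  integrated.\<close>

lemma volume_graph_le:
  fixes f :: "real^'n \<Rightarrow> real^'m" and \<Xi> :: "real^'n \<Rightarrow> (real^'n) \<times> (real^'m)"
  assumes D: "open D" and K: "compact K" "K \<subseteq> D" and f: "Ck_on 2 D f"
    and min: "minimal_on D (graph_param f)"
    and short: "\<And>x v. x \<in> D \<Longrightarrow> norm (frechet_derivative f (at x) v) \<le> norm v"
    and \<Xi>: "Ck_on 1 D \<Xi>" and outside: "\<And>x. x \<in> D - K \<Longrightarrow> \<Xi> x = graph_param f x"
    and X: "\<And>x v. x \<in> D \<Longrightarrow> norm (fst (frechet_derivative \<Xi> (at x) v) - v) \<le> norm v / 2"
    and Y: "\<And>x v. x \<in> D \<Longrightarrow> norm (snd (frechet_derivative \<Xi> (at x) v))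
              \<le> norm (fst (frechet_derivative \<Xi> (at x) v))"
  shows "volume K (graph_param f) \<le> volume K \<Xi>"
proof -
  let ?F = "graph_param f"
  define df where "df x = frechet_derivative f (at x)" for x
  define dX where "dX x v = fst (frechet_derivative \<Xi> (at x) v)" for x v
  define dY where "dY x v = snd (frechet_derivative \<Xi> (at x) v)" for x v
  have f': "Ck_on (Suc (Suc 0)) D f" using f by (simp add: numeral_2_eq_2)
  have \<Xi>': "Ck_on (Suc 0) D \<Xi>" using \<Xi> by simp
  have F': "Ck_on (Suc (Suc 0)) D ?F" by (rule Ck_on_graph_param[OF D f'])
  have df: "(f has_derivative df x) (at x)" if "x \<in> D" for x
    unfolding df_def by (rule Ck_on_Suc_has_derivative[OF f' that])
  have d\<Xi>: "(\<Xi> has_derivative (\<lambda>v. (dX x v, dY x v))) (at x)" if "x \<in> D" for x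
    using Ck_on_Suc_has_derivative[OF \<Xi>' that] by (simp add: dX_def dY_def)
  have metric_F: "induced_metric ?F x = gram (matrix (df x))" if "x \<in> D" for x
    by (rule induced_metric_graph_param[OF df[OF that]])
  have pos: "det (induced_metric ?F x) > 0" if "x \<in> D" for x
    by (simp add: metric_F[OF that] det_gram_pos)
  have open': "open (- K)" using K by (simp add: compact_imp_closed open_Compl)

  \<comment> \<open>The extension of the first component of \<open>\<Xi>\<close> by the identity is a bijection of the whole space
    that preserves \<open>K\<close> and \<open>D\<close>.\<close>
  define g where "g x = (if x \<in> K then fst (\<Xi> x) else x)" for x
  define g' where "g' x = (if x \<in> D then dX x else (\<lambda>v. v))" for x
  have g_D: "g x = fst (\<Xi> x)" if "x \<in> D" for x
    using outside[of x] that by (auto simp: g_def graph_param_def)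
  have dg: "(g has_derivative g' x) (at x)" for x
  proof (cases "x \<in> D")
    case True
    have "((\<lambda>x. fst (\<Xi> x)) has_derivative dX x) (at x)"
      using has_derivative_fst[OF d\<Xi>[OF True]] by simp
    then have "(g has_derivative dX x) (at x)"
      by (rule has_derivative_transform_within_open[OF _ D True]) (simp add: g_D)
    then show ?thesis by (simp add: g'_def True)
  next
    case False
    have "(g has_derivative (\<lambda>v. v)) (at x)"
      by (rule has_derivative_transform_within_open[OF has_derivative_ident open'])
        (use False K in \<open>auto simp: g_def\<close>)
    then show ?thesis by (simp add: g'_def False)
  qed
  have close: "norm (g' x v - v) \<le> norm v / 2" for x v
    using X by (auto simp: g'_def dX_def)
  note g_bij = near_identity_bij(1)[OF dg close] and expand = near_identity_bij(2)[OF dg close]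
  define p where "p = inv g"
  have gp: "g (p y) = y" and pg: "p (g x) = x" for x y
    using g_bij by (simp_all add: p_def bij_is_inj bij_is_surj surj_f_inv_f)
  \<comment> \<open>Outside \<open>K\<close> the map is the identity, so by injectivity no point of
    \<open>K\<close> can be sent outside.\<close>
  have g_K: "g x \<in> K \<longleftrightarrow> x \<in> K" for x
  proof
    assume "g x \<in> K" then show "x \<in> K" by (metis g_def)
  next
    assume "x \<in> K"
    show "g x \<in> K"
    proof (rule ccontr)
      assume "g x \<notin> K"
      then have "g (g x) = g x" by (simp add: g_def)
      then have "g x = x" by (metis pg)
      then show False using \<open>g x \<notin> K\<close> \<open>x \<in> K\<close> by simp
    qed
  qed
  have p_K: "p y \<in> K \<longleftrightarrow> y \<in> K" for y using g_K[of "p y"] by (simp add: gp)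
  have p_out: "p y = y" if "y \<notin> K" for y using that p_K[of y] gp[of y] by (simp add: g_def)
  have p_D: "p y \<in> D" if "y \<in> D" for y
    using that K p_K[of y] p_out[of y] by (cases "y \<in> K") auto
  have g_image: "g ` K = K"
  proof
    show "g ` K \<subseteq> K" using g_K by blast
    show "K \<subseteq> g ` K" using p_K gp by (metis imageI subsetI)
  qed

  define L where "L y = inv (g' (p y))" for y
  have lin: "linear (g' x)" for x by (rule has_derivative_linear[OF dg])
  have inj: "inj (g' x)" for x
  proof -
    have "v = 0" if "g' x v = 0" for v using close[of x v] that by simp
    then show ?thesis using linear_injective_0[OF lin] by blast
  qed
  have L: "L y (g' (p y) v) = v" "g' (p y) (L y v) = v" for y v
    using inj lin by (simp_all add: L_def linear_inj_imp_surj surj_f_inv_f)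
  have lin_L: "linear (L y)"
    for y unfolding L_def by (intro inj_linear_imp_inv_linear lin inj)
  \<comment> \<open>The expansion estimate makes \<open>p\<close> Lipschitz with constant 2; this
    continuity and the pointwise inverses \<open>L\<close> yield the derivative of
    \<open>p\<close>.\<close>
  have "continuous (at y) p" for y
    unfolding continuous_at_eps_delta
  proof (intro allI impI)
    fix e :: real assume "e > 0"
    have "dist (p z) (p y) < e" if "dist z y < e / 2" for z
      using expand[of "p z" "p y"] that by (simp add: gp dist_norm)
    then show "\<exists>d>0. \<forall>z. dist z y < d \<longrightarrow> dist (p z) (p y) < e"
      using \<open>e > 0\<close> by (intro exI[of _ "e / 2"]) auto
  qed
  then have dp: "(p has_derivative L y) (at y)" for y
    using lin_L L gp
    by (intro has_derivative_inverse_basic[OF dg, where T=UNIV])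
      (auto simp: linear_conv_bounded_linear fun_eq_iff)

  \<comment> \<open>\<open>\<Xi>\<close> reparametrizes the graph of \<open>snd \<circ> \<Xi> \<circ> p\<close>, which differs from \<open>f\<close> by \<open>\<phi>\<close>.\<close>
  define dh where "dh y v = dY (p y) (L y v)" for y v
  define \<phi> where "\<phi> y = (if y \<in> D then snd (\<Xi> (p y)) - f y else 0)" for y
  define d\<phi> where "d\<phi> y v = (if y \<in> D then dh y v - df y v else 0)" for y v
  have \<phi>_out: "\<phi> y = 0" if "y \<notin> K" for y
    using that outside[of y] by (simp add: \<phi>_def p_out graph_param_def)
  have dh: "((\<lambda>y. snd (\<Xi> (p y))) has_derivative dh y) (at y)" if "y \<in> D" for y
  proof -
    have "((\<lambda>y. \<Xi> (p y)) has_derivative (\<lambda>v. (dX (p y) (L y v), dY (p y) (L y v)))) (at y)"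
      by (rule has_derivative_compose[OF dp d\<Xi>[OF p_D[OF that]]])
    then show ?thesis using has_derivative_snd by (fastforce simp: dh_def[abs_def])
  qed
  have d\<phi>: "(\<phi> has_derivative d\<phi> y) (at y)" for y
  proof (cases "y \<in> D")
    case True
    have "((\<lambda>y. snd (\<Xi> (p y)) - f y) has_derivative (\<lambda>v. dh y v - df y v)) (at y)"
      by (intro has_derivative_diff dh df True)
    then have "(\<phi> has_derivative (\<lambda>v. dh y v - df y v)) (at y)"
      by (rule has_derivative_transform_within_open[OF _ D True]) (simp add: \<phi>_def)
    moreover have "d\<phi> y = (\<lambda>v. dh y v - df y v)" using True by (simp add: d\<phi>_def fun_eq_iff)
    ultimately show ?thesis by simp
  next
    case False
    have "(\<phi> has_derivative (\<lambda>v. 0)) (at y)"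
      by (rule has_derivative_transform_within_open[OF has_derivative_const open'])
        (use False K \<phi>_out in auto)
    moreover have "d\<phi> y = (\<lambda>v. 0)" using False by (simp add: d\<phi>_def fun_eq_iff)
    ultimately show ?thesis by simp
  qed
  \<comment> \<open>For \<open>w = L y v\<close> the horizontal derivative maps \<open>w\<close> to
    \<open>v\<close>, so \<open>Y\<close> applied to \<open>w\<close> is exactly the claim.\<close>
  have dh_short: "norm (dh y v) \<le> norm v" if "y \<in> D" for y v
    using Y[OF p_D[OF that], of "L y v"] L(2)[of y v] p_D[OF that]
    by (simp add: dh_def dY_def g'_def dX_def)
  have df_short: "norm (df y v) \<le> norm v" if "y \<in> D" for y v
    using short[OF that] by (simp add: df_def)
  have lin_dh: "linear (dh y)" if "y \<in> D" for y by (rule has_derivative_linear[OF dh[OF that]])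
  have lin_df: "linear (df y)" if "y \<in> D" for y by (rule has_derivative_linear[OF df[OF that]])

  \<comment> \<open>\<open>W i\<close> is the gradient of the area density with respect to the
    \<open>i\<close>-th column of the Jacobian of \<open>f\<close>. Its vanishing divergence is the
    minimal surface system, and \<open>W_T\<close> below identifies its pairing with
    \<open>d\<phi>\<close> as the linear term of the tangent inequality.\<close>
  define W where "W i y = snd (weighted_gradient ?F i y)" for i y
  have W1: "Ck_on (Suc 0) D (W i)" for i
    unfolding W_def[abs_def]
    by (intro Ck_on_bounded_linear[OF D bounded_linear_snd] Ck_on_weighted_gradient D F' pos)
  have dW: "(W i has_derivative frechet_derivative (W i) (at y)) (at y)" if "y \<in> D" for i y
    by (rule Ck_on_Suc_has_derivative[OF W1 that])
  have div_W: "(\<Sum>i\<in>UNIV. partial_d i (W i) y) = 0" if y: "y \<in> D" for y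
  proof -
    have "partial_d i (W i) y = snd (partial_d i (weighted_gradient ?F i) y)" for i
      using has_derivative_snd[OF Ck_on_Suc_has_derivative[OF Ck_on_weighted_gradient[OF D F' pos] y]]
      unfolding W_def by (subst partial_d_eq) (auto simp: partial_d_def)
    moreover have "(\<Sum>i\<in>UNIV. partial_d i (weighted_gradient ?F i) y) = 0"
      by (rule weighted_gradient_divergence_free[OF D _ min pos y]) (use F' in \<open>simp add: numeral_2_eq_2\<close>)
    ultimately show ?thesis by (simp add: snd_sum[symmetric])
  qed
  define T where "T y = trace (matrix_inv (gram (matrix (df y))) ** transpose (matrix (df y))
    ** (matrix (dh y) - matrix (df y)))" for y
  have W_T: "(\<Sum>i\<in>UNIV. W i y \<bullet> d\<phi> y (axis i 1)) = area_density (matrix (df y)) * T y"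
    if y: "y \<in> D" for y
  proof -
    have Wi: "W i y = (\<Sum>j\<in>UNIV. (area_density (matrix (df y)) *
        matrix_inv (gram (matrix (df y))) $ i $ j) *\<^sub>R df y (axis j 1))" for i
      using partial_d_eq[OF has_derivative_graph_param[OF df[OF y]]]
      by (simp add: W_def weighted_gradient_def metric_F[OF y] area_density_def snd_sum snd_scaleR)
    have "W i y \<bullet> d\<phi> y (axis i 1) = area_density (matrix (df y)) * (\<Sum>j\<in>UNIV.
        matrix_inv (gram (matrix (df y))) $ i $ j * (df y (axis j 1) \<bullet> (dh y (axis i 1) - df y (axis i 1))))" for i
      unfolding Wi using y by (simp add: inner_sum_left sum_distrib_left d\<phi>_def mult.assoc)
    moreover have "T y = (\<Sum>i\<in>UNIV. \<Sum>j\<in>UNIV. matrix_inv (gram (matrix (df y))) $ i $ j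
        * (df y (axis j 1) \<bullet> (dh y (axis i 1) - df y (axis i 1))))"
      unfolding T_def matrix_mul_assoc[symmetric]
      by (simp add: trace_def matrix_matrix_mult_def[of "matrix_inv _"])
        (simp add: matrix_matrix_mult_def transpose_def matrix_def inner_vec_def)
    ultimately show ?thesis by (simp add: sum_distrib_left)
  qed

  \<comment> \<open>This is the \<open>i\<close>-th derivative of
    \<open>W i y \<bullet> \<phi> y\<close>, extended by zero. Summed over \<open>i\<close>, its
    second half drops out by \<open>div_W\<close>.\<close>
  define \<psi>' where "\<psi>' i y = (if y \<in> D then W i y \<bullet> d\<phi> y (axis i 1) + partial_d i (W i) y \<bullet> \<phi> y else 0)" for i y
  have int_\<psi>: "(\<psi>' i has_integral 0) K" for i
  proof -
    define \<psi> where "\<psi> y = (if y \<in> D then W i y \<bullet> \<phi> y else 0)" for y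
    define \<psi>d where "\<psi>d y v = (if y \<in> D then W i y \<bullet> d\<phi> y v + frechet_derivative (W i) (at y) v \<bullet> \<phi> y else 0)" for y v
    have d\<psi>: "(\<psi> has_derivative \<psi>d y) (at y)" for y
    proof (cases "y \<in> D")
      case True
      have "((\<lambda>y. W i y \<bullet> \<phi> y) has_derivative
          (\<lambda>v. W i y \<bullet> d\<phi> y v + frechet_derivative (W i) (at y) v \<bullet> \<phi> y)) (at y)"
        by (intro has_derivative_inner dW True d\<phi>)
      then have "(\<psi> has_derivative (\<lambda>v. W i y \<bullet> d\<phi> y v + frechet_derivative (W i) (at y) v \<bullet> \<phi> y)) (at y)"
        by (rule has_derivative_transform_within_open[OF _ D True]) (simp add: \<psi>_def)
      moreover have "\<psi>d y = (\<lambda>v. W i y \<bullet> d\<phi> y v + frechet_derivative (W i) (at y) v \<bullet> \<phi> y)"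
        using True by (simp add: \<psi>d_def fun_eq_iff)
      ultimately show ?thesis by simp
    next
      case False
      have "(\<psi> has_derivative (\<lambda>v. 0)) (at y)"
        by (rule has_derivative_transform_within_open[OF has_derivative_const open'])
          (use False K \<phi>_out in \<open>auto simp: \<psi>_def\<close>)
      moreover have "\<psi>d y = (\<lambda>v. 0)" using False by (simp add: \<psi>d_def fun_eq_iff)
      ultimately show ?thesis by simp
    qed
    have \<psi>d: "\<psi>d y (axis i 1) = \<psi>' i y" for y by (simp add: \<psi>d_def \<psi>'_def partial_d_def)
    have "((\<lambda>s. \<psi> (y + s *\<^sub>R axis i 1)) has_real_derivative \<psi>' i y) (at 0)" for y
      using has_real_derivative_partial_d[of \<psi> y i] d\<psi>[of y] partial_d_eq[OF d\<psi>, of i y] \<psi>d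
      by (metis differentiableI)
    moreover have "continuous_on UNIV \<psi>"
      using d\<psi> has_derivative_continuous by (blast intro: continuous_at_imp_continuous_on)
    moreover have "\<psi> y = 0" if "y \<notin> K" for y using \<phi>_out[OF that] by (simp add: \<psi>_def)
    \<comment> \<open>A bound suffices for the translation argument. On \<open>K\<close> it comes
      from \<open>dh_short\<close> and \<open>df_short\<close>, each contributing 1 on a unit
      vector, so continuity of \<open>dh\<close> need not be proved.\<close>
    moreover have "\<exists>M. \<forall>y. \<bar>\<psi>' i y\<bar> \<le> M"
    proof -
      have "continuous_on K (W i)" "continuous_on K (partial_d i (W i))"
        using Ck_on_imp_continuous_on[OF W1] Ck_on_imp_continuous_on[OF Ck_on_partial_d[OF W1]]
          continuous_on_subset[OF _ K(2)] by blast+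
      moreover have "continuous_on K \<phi>"
        using d\<phi> has_derivative_continuous by (blast intro: continuous_at_imp_continuous_on)
      ultimately have "\<exists>B. \<forall>y\<in>K. norm (W i y) \<le> B" "\<exists>B. \<forall>y\<in>K. norm (partial_d i (W i) y) \<le> B"
        "\<exists>B. \<forall>y\<in>K. norm (\<phi> y) \<le> B"
        by (auto dest!: compact_imp_bounded[OF compact_continuous_image[OF _ K(1)]] simp: bounded_iff)
      then obtain B1 B2 B3 where B: "\<And>y. y \<in> K \<Longrightarrow> norm (W i y) \<le> B1"
        "\<And>y. y \<in> K \<Longrightarrow> norm (partial_d i (W i) y) \<le> B2" "\<And>y. y \<in> K \<Longrightarrow> norm (\<phi> y) \<le> B3"
        by metis
      have "\<bar>\<psi>' i y\<bar> \<le> \<bar>B1\<bar> * 2 + \<bar>B2\<bar> * \<bar>B3\<bar>" for y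
      proof (cases "y \<in> K")
        case True
        then have y: "y \<in> D" using K by blast
        have "norm (d\<phi> y (axis i 1)) \<le> norm (dh y (axis i 1)) + norm (df y (axis i 1))"
          using y by (simp add: d\<phi>_def norm_triangle_ineq4)
        also have "\<dots> \<le> 2" using dh_short[OF y, of "axis i 1"] df_short[OF y, of "axis i 1"] by simp
        finally have "norm (d\<phi> y (axis i 1)) \<le> 2" .
        moreover have "norm (W i y) \<le> \<bar>B1\<bar>" "norm (partial_d i (W i) y) \<le> \<bar>B2\<bar>" "norm (\<phi> y) \<le> \<bar>B3\<bar>"
          using B[OF True] by auto
        ultimately have "norm (W i y) * norm (d\<phi> y (axis i 1)) \<le> \<bar>B1\<bar> * 2"
          "norm (partial_d i (W i) y) * norm (\<phi> y) \<le> \<bar>B2\<bar> * \<bar>B3\<bar>"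
          by (intro mult_mono; simp)+
        moreover have "\<bar>\<psi>' i y\<bar> \<le> \<bar>W i y \<bullet> d\<phi> y (axis i 1)\<bar> + \<bar>partial_d i (W i) y \<bullet> \<phi> y\<bar>"
          using y by (simp add: \<psi>'_def)
        ultimately show ?thesis
          using Cauchy_Schwarz_ineq2[of "W i y" "d\<phi> y (axis i 1)"]
            Cauchy_Schwarz_ineq2[of "partial_d i (W i) y" "\<phi> y"] by linarith
      next
        case False
        have "\<psi>' i y = 0"
        proof (cases "y \<in> D")
          case True
          have "(\<phi> has_derivative (\<lambda>v. 0)) (at y)"
            by (rule has_derivative_transform_within_open[OF has_derivative_const open'])
              (use False \<phi>_out in auto)
          then have "d\<phi> y = (\<lambda>v. 0)" using d\<phi> has_derivative_unique by blast
          then show ?thesis using \<phi>_out[OF False] by (simp add: \<psi>'_def)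
        qed (simp add: \<psi>'_def)
        then show ?thesis by simp
      qed
      then show ?thesis by blast
    qed
    ultimately show ?thesis using has_integral_directional_derivative[OF K(1)] by metis
  qed
  have int_T: "((\<lambda>y. area_density (matrix (df y)) * T y) has_integral 0) K"
  proof -
    have "((\<lambda>y. \<Sum>i\<in>UNIV. \<psi>' i y) has_integral (\<Sum>i\<in>(UNIV::'n set). 0)) K"
      by (intro has_integral_sum int_\<psi>) simp
    then have sum: "((\<lambda>y. \<Sum>i\<in>UNIV. \<psi>' i y) has_integral 0) K" by simp
    have "(\<Sum>i\<in>UNIV. \<psi>' i y) = area_density (matrix (df y)) * T y" if "y \<in> K" for y
    proof -
      have y: "y \<in> D" using that K by blast
      then have "(\<Sum>i\<in>UNIV. \<psi>' i y) = (\<Sum>i\<in>UNIV. W i y \<bullet> d\<phi> y (axis i 1))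
          + (\<Sum>i\<in>UNIV. partial_d i (W i) y) \<bullet> \<phi> y"
        by (simp add: \<psi>'_def sum.distrib inner_sum_left)
      then show ?thesis using W_T[OF y] div_W[OF y] by simp
    qed
    from has_integral_eq[OF this sum] show ?thesis .
  qed
  have int_F: "((\<lambda>y. area_density (matrix (df y))) has_integral volume K ?F) K"
  proof -
    have "((\<lambda>y. sqrt (det (induced_metric ?F y))) has_integral volume K ?F) K"
      unfolding volume_def
      by (intro integrable_integral integrable_on_compact K
          continuous_on_sqrt_det_induced_metric[OF D Ck_on_Suc_imp[OF F']])
    then show ?thesis
      by (rule has_integral_eq[rotated]) (use K metric_F in \<open>auto simp: area_density_def\<close>)
  qed
  \<comment> \<open>The metric of \<open>\<Xi>\<close> is the pullback under \<open>g\<close> of the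
    metric of the graph with derivative \<open>dh\<close>. Its volume density therefore carries the
    factor \<open>\<bar>det (matrix (g' x))\<bar>\<close>, which the change of variables
    removes.\<close>
  have int_\<Xi>: "((\<lambda>y. area_density (matrix (dh y))) has_integral volume K \<Xi>) K"
  proof -
    have "((\<lambda>x. sqrt (det (induced_metric \<Xi> x))) has_integral volume K \<Xi>) K"
      unfolding volume_def
      by (intro integrable_integral integrable_on_compact K
          continuous_on_sqrt_det_induced_metric[OF D \<Xi>'])
    then have "((\<lambda>x. \<bar>det (matrix (g' x))\<bar> * area_density (matrix (dh (g x)))) has_integral volume K \<Xi>) K"
    proof (rule has_integral_eq[rotated])
      fix x assume "x \<in> K"
      then have x: "x \<in> D" using K by blast
      then have gx: "g x \<in> D" using g_K[of x] \<open>x \<in> K\<close> K by blast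
      have "dY x v = dh (g x) (g' x v)" for v
        using L(1)[of "g x" v] by (simp add: dh_def pg)
      then have "dY x = dh (g x) \<circ> g' x" by (simp add: fun_eq_iff)
      then have "matrix (dY x) = matrix (dh (g x)) ** matrix (g' x)"
        using matrix_compose[OF lin lin_dh[OF gx]] by simp
      moreover have "matrix (dX x) = matrix (g' x)" using x by (simp add: g'_def)
      ultimately have "induced_metric \<Xi> x
          = transpose (matrix (g' x)) ** gram (matrix (dh (g x))) ** matrix (g' x)"
        using induced_metric_eq[OF d\<Xi>[OF x]]
        by (simp add: matrix_transpose_mul gram_def matrix_add_ldistrib matrix_add_rdistrib matrix_mul_assoc)
      then have "det (induced_metric \<Xi> x) = (det (matrix (g' x)))\<^sup>2 * det (gram (matrix (dh (g x))))"
        by (simp add: det_mul power2_eq_square)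
      then show "sqrt (det (induced_metric \<Xi> x)) = \<bar>det (matrix (g' x))\<bar> * area_density (matrix (dh (g x)))"
        by (simp add: real_sqrt_mult area_density_def)
    qed
    then have "((\<lambda>y. area_density (matrix (dh y))) has_integral volume K \<Xi>) (g ` K)"
      by (intro change_of_variables_nonneg[OF K(1) has_derivative_at_withinI[OF dg]])
        (auto simp: less_imp_le[OF area_density_pos] intro: inj_on_subset[OF bij_is_inj[OF g_bij]])
    then show ?thesis by (simp add: g_image)
  qed
  have "volume K ?F + 0 \<le> volume K \<Xi>"
  proof (rule has_integral_le[OF has_integral_add[OF int_F int_T] int_\<Xi>])
    fix y assume "y \<in> K"
    then have y: "y \<in> D" using K by blast
    have mv: "matrix (df y) *v v = df y v" "matrix (dh y) *v v = dh y v" for v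
      using matrix_works lin_df[OF y] lin_dh[OF y] by (metis linear_matrix_vector_mul_eq)+
    have "area_density (matrix (df y)) * (1 + T y)
        \<le> area_density (matrix (df y) + (matrix (dh y) - matrix (df y)))"
      unfolding T_def
      by (rule area_density_tangent_le) (use df_short[OF y] dh_short[OF y] in \<open>simp_all add: mv\<close>)
    then show "area_density (matrix (df y)) + area_density (matrix (df y)) * T y
        \<le> area_density (matrix (dh y))"
      by (simp add: algebra_simps)
  qed
  then show ?thesis by simp
qed

subsection \<open>Variations of minimal graphs\<close>

lemma Ck_on_subset: "Ck_on k T f \<Longrightarrow> S \<subseteq> T \<Longrightarrow> Ck_on k S f"
proof (induction k arbitrary: f)
  case 0
  then show ?case using continuous_on_subset by auto
next
  case (Suc k)
  have "Ck_on k S (\<lambda>x. frechet_derivative f (at x) v)" for v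
    by (rule Suc.IH[OF Ck_on_SucD[OF Suc.prems(1)] Suc.prems(2)])
  then show ?case using Suc.prems by auto
qed

lemma has_derivative_slice:
  assumes "\<Psi> differentiable (at (t, x))"
  shows "((\<lambda>x. \<Psi> (t, x)) has_derivative (\<lambda>v. frechet_derivative \<Psi> (at (t, x)) (0, v))) (at x)"
proof -
  have "((\<lambda>x. (t, x)) has_derivative (\<lambda>v. (0, v))) (at x)"
    by (intro has_derivative_Pair has_derivative_const has_derivative_ident)
  then show ?thesis
    using assms frechet_derivative_works by (blast intro: has_derivative_compose)
qed

lemma DERIV_time_slice:
  fixes w :: "real \<times> 'a::real_normed_vector \<Rightarrow> real"
  assumes "w differentiable (at (t, x))"
  shows "((\<lambda>s. w (s, x)) has_real_derivative frechet_derivative w (at (t, x)) (1, 0)) (at t)"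
  using has_vector_derivative_line[of w "(0, x)" t "(1, 0)"] assms
  by (simp add: has_real_derivative_iff_has_vector_derivative)

text \<open>Reduces an estimate uniform over all directions to finitely many coordinate directions,
  for which joint continuity in time and space is available.\<close>

lemma norm_linear_le_sum_axis:
  fixes L :: "real^'n \<Rightarrow> 'a::real_normed_vector"
  assumes "linear L"
  shows "norm (L v) \<le> (\<Sum>i\<in>UNIV. norm (L (axis i 1))) * norm v"
proof -
  have "L v = L (\<Sum>i\<in>UNIV. v $ i *\<^sub>R axis i 1)"
    using basis_expansion[of v] by (simp add: scalar_mult_eq_scaleR)
  also have "\<dots> = (\<Sum>i\<in>UNIV. v $ i *\<^sub>R L (axis i 1))"
    by (simp add: linear_sum[OF assms] linear_scale[OF assms])
  also have "norm \<dots> \<le> (\<Sum>i\<in>UNIV. norm v * norm (L (axis i 1)))"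
    by (intro sum_norm_le) (simp add: mult_right_mono component_le_norm_cart)
  finally show ?thesis by (simp add: sum_distrib_left[symmetric] mult.commute)
qed

text \<open>The horizontal part alone has trivial kernel, so the nearby surfaces remain immersed and
  the square root in the volume density stays smooth.\<close>

lemma det_induced_metric_pos:
  fixes F :: "real^'n \<Rightarrow> (real^'n) \<times> (real^'m)"
  assumes F: "(F has_derivative F') (at x)" and close: "\<And>v. norm (fst (F' v) - v) \<le> norm v / 2"
  shows "det (induced_metric F x) > 0"
proof (rule det_pos_definite)
  fix u :: "real^'n" assume "u \<noteq> 0"
  define A where "A = matrix (\<lambda>v. fst (F' v))"
  define B where "B = matrix (\<lambda>v. snd (F' v))"
  have "linear (\<lambda>v. fst (F' v))"
    using has_derivative_linear[OF has_derivative_fst[OF F]] by simp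
  then have "A *v u = fst (F' u)" by (simp add: A_def matrix_works linear_matrix_vector_mul_eq)
  then have "A *v u \<noteq> 0" using close[of u] \<open>u \<noteq> 0\<close> by auto
  moreover have "u \<bullet> (induced_metric F x *v u) = (A *v u) \<bullet> (A *v u) + (B *v u) \<bullet> (B *v u)"
    unfolding induced_metric_eq[OF F] A_def[symmetric] B_def[symmetric]
    by (simp only: matrix_vector_mult_add_rdistrib inner_add_right matrix_vector_mul_assoc[symmetric]
        inner_transpose_mult)
  ultimately show "u \<bullet> (induced_metric F x *v u) > 0" by (simp add: add_pos_nonneg)
qed

text \<open>Compactness of \<open>K\<close> makes one time interval work for all points, so
  \<open>volume_graph_le\<close> applies throughout it. The volume is then differentiated twice
  under the integral sign.\<close>

lemma second_derivative_volume_nonneg: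
  fixes f :: "real^'n \<Rightarrow> real^'m"
  assumes D: "open D" and f: "smooth_on D f" and min: "minimal_on D (graph_param f)"
    and short: "\<And>x v. x \<in> D \<Longrightarrow> norm (frechet_derivative f (at x) v) \<le> \<beta> * norm v" and "\<beta> < 1"
    and variation: "normal_variation D (graph_param f) K \<Phi>"
  shows "deriv (deriv (\<lambda>t. volume K (\<Phi> t))) 0 \<ge> 0"
proof -
  let ?F = "graph_param f"
  have K: "compact K" "K \<subseteq> D" and \<Phi>0: "\<And>x. x \<in> D \<Longrightarrow> \<Phi> 0 x = ?F x"
    using variation by (auto simp: normal_variation_def)
  obtain \<epsilon> where "\<epsilon> > 0" and smooth: "smooth_on ({-\<epsilon><..<\<epsilon>} \<times> D) (\<lambda>(t, x). \<Phi> t x)"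
    and outside: "\<And>t x. t \<in> {-\<epsilon><..<\<epsilon>} \<Longrightarrow> x \<in> D - K \<Longrightarrow> \<Phi> t x = ?F x"
    using variation by (auto simp: normal_variation_def)
  define U where "U = {-\<epsilon><..<\<epsilon>} \<times> D"
  define \<Psi> where "\<Psi> = (\<lambda>(t, x). \<Phi> t x)"
  define d\<Phi> where "d\<Phi> t x v = frechet_derivative \<Psi> (at (t, x)) (0, v)" for t x v
  define h where "h i z = frechet_derivative \<Psi> (at z) (0, axis i 1)" for i :: 'n and z
  have U: "open U" unfolding U_def by (intro open_Times D open_greaterThanLessThan)
  have \<Psi>: "Ck_on k U \<Psi>" for k using smooth by (simp add: smooth_on_def U_def \<Psi>_def)
  have h: "Ck_on k U (h i)" for k i
    unfolding h_def[abs_def] by (rule Ck_on_SucD[OF \<Psi>])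
  have d\<Phi>: "(\<Phi> t has_derivative d\<Phi> t x) (at x)" if "(t, x) \<in> U" for t x
    using has_derivative_slice[of \<Psi> t x] \<Psi>[of 1] that by (simp add: \<Psi>_def d\<Phi>_def[abs_def])
  have h_d\<Phi>: "h i (t, x) = d\<Phi> t x (axis i 1)" for i t x by (simp add: h_def d\<Phi>_def)
  have frechet_\<Phi>: "frechet_derivative (\<Phi> t) (at x) = d\<Phi> t x" if "(t, x) \<in> U" for t x
    using frechet_derivative_at[OF d\<Phi>[OF that]] by simp
  have \<Phi>1: "Ck_on 1 D (\<Phi> t)" if t: "t \<in> {-\<epsilon><..<\<epsilon>}" for t
  proof -
    have "continuous_on D (\<lambda>x. d\<Phi> t x v)" for v
    proof -
      have "continuous_on U (\<lambda>z. frechet_derivative \<Psi> (at z) (0, v))"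
        using Ck_on_SucD[OF \<Psi>[of "Suc 0"]] by simp
      then show ?thesis
        unfolding d\<Phi>_def
        by (rule continuous_on_compose2) (use t in \<open>auto simp: U_def intro!: continuous_intros\<close>)
    qed
    then have "Ck_on (Suc 0) D (\<Phi> t)"
      by (intro Ck_on_SucI[OF D d\<Phi>]) (use t in \<open>auto simp: U_def\<close>)
    then show ?thesis by simp
  qed
  have f_Ck: "Ck_on k D f" for k using f by (simp add: smooth_on_def)
  define df where "df x = frechet_derivative f (at x)" for x
  have df: "(f has_derivative df x) (at x)" if "x \<in> D" for x
    unfolding df_def by (rule Ck_on_Suc_has_derivative[OF f_Ck that])
  have dF: "(?F has_derivative (\<lambda>v. (v, df x v))) (at x)" if "x \<in> D" for x
    by (rule has_derivative_graph_param[OF df[OF that]])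

  \<comment> \<open>\<eta> bounds the drift of both derivative components: the vertical one stays
    below \<open>\<beta> + \<eta>\<close> and the horizontal one above \<open>1 - \<eta>\<close>, in
    the right order by the choice \<open>(1 - \<beta>) / 2\<close>. The cap 1/2 is the one demanded
    by \<open>near_identity_bij\<close>.\<close>
  define \<eta> where "\<eta> = min (1 / 2) ((1 - \<beta>) / 2)"
  have \<eta>: "\<eta> > 0" "\<eta> \<le> 1 / 2" "\<beta> + \<eta> \<le> 1 - \<eta>"
  proof -
    have "\<eta> \<le> (1 - \<beta>) / 2" unfolding \<eta>_def by (rule min.cobounded2)
    then show "\<beta> + \<eta> \<le> 1 - \<eta>" by (simp add: field_simps)
  qed (use \<open>\<beta> < 1\<close> in \<open>auto simp: \<eta>_def\<close>)
  \<comment> \<open>\<open>q\<close> measures the drift from time 0 in the coordinate directions and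
    vanishes at time 0. Uniform continuity on the compact set below, whose times stay within half of
    \<epsilon>, makes it small for all points of \<open>K\<close> at once.\<close>
  define q where "q z = (\<Sum>i\<in>UNIV. norm (h i z - h i (0, snd z)))" for z
  obtain \<delta>0 where "\<delta>0 > 0" and q: "\<And>t x. \<bar>t\<bar> < \<delta>0 \<Longrightarrow> \<bar>t\<bar> \<le> \<epsilon> / 2 \<Longrightarrow> x \<in> K \<Longrightarrow> q (t, x) < \<eta>"
  proof -
    let ?C = "{-(\<epsilon> / 2)..\<epsilon> / 2} \<times> K"
    have C: "?C \<subseteq> U" "(\<lambda>z. (0, snd z)) ` ?C \<subseteq> U" using \<open>\<epsilon> > 0\<close> K by (auto simp: U_def)
    have ch: "continuous_on U (h i)" for i by (rule Ck_on_imp_continuous_on[OF h])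
    have "continuous_on ?C q"
      unfolding q_def[abs_def]
      by (intro continuous_intros continuous_on_subset[OF ch C(1)] continuous_on_compose2[OF ch _ C(2)])
    then have "uniformly_continuous_on ?C q"
      by (intro compact_uniformly_continuous compact_Times compact_Icc K)
    then obtain d where d: "d > 0"
      "\<And>z y. z \<in> ?C \<Longrightarrow> y \<in> ?C \<Longrightarrow> dist y z < d \<Longrightarrow> dist (q y) (q z) < \<eta>"
      using \<eta>(1) unfolding uniformly_continuous_on_def by meson
    have "q (t, x) < \<eta>" if "\<bar>t\<bar> < d" "\<bar>t\<bar> \<le> \<epsilon> / 2" "x \<in> K" for t x
    proof -
      have "dist (q (t, x)) (q (0, x)) < \<eta>"
        using that \<open>\<epsilon> > 0\<close> by (intro d(2)) (auto simp: dist_Pair_Pair dist_real_def)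
      moreover have "q (0, x) = 0" by (simp add: q_def)
      ultimately show ?thesis by (simp add: dist_real_def)
    qed
    then show thesis using that d(1) by blast
  qed
  define \<delta> where "\<delta> = min \<delta>0 (\<epsilon> / 2)"
  have \<delta>: "\<delta> > 0" using \<open>\<delta>0 > 0\<close> \<open>\<epsilon> > 0\<close> by (simp add: \<delta>_def)
  have in_time: "t \<in> {-\<epsilon><..<\<epsilon>}" if "\<bar>t\<bar> < \<delta>" for t
    using that \<open>\<epsilon> > 0\<close> by (auto simp: \<delta>_def)
  then have in_U: "(t, x) \<in> U" if "\<bar>t\<bar> < \<delta>" "x \<in> D" for t x
    using that by (auto simp: U_def)
  have d\<Phi>0: "d\<Phi> 0 x = (\<lambda>v. (v, df x v))" if "x \<in> D" for x
  proof -
    have "(?F has_derivative d\<Phi> 0 x) (at x)"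
      using has_derivative_transform_within_open[OF d\<Phi>[OF in_U] D that \<Phi>0] \<delta> that by simp
    then show ?thesis using dF[OF that] has_derivative_unique by blast
  qed
  have close: "norm (d\<Phi> t x v - (v, df x v)) \<le> \<eta> * norm v" if t: "\<bar>t\<bar> < \<delta>" and x: "x \<in> D" for t x v
  proof (cases "x \<in> K")
    case True
    have "linear (\<lambda>v. d\<Phi> t x v - d\<Phi> 0 x v)"
      by (rule has_derivative_linear[OF has_derivative_diff[OF d\<Phi> d\<Phi>]])
        (use in_U t x \<delta> in auto)
    then have "norm (d\<Phi> t x v - d\<Phi> 0 x v) \<le> q (t, x) * norm v"
      using norm_linear_le_sum_axis[of "\<lambda>v. d\<Phi> t x v - d\<Phi> 0 x v" v] by (simp add: q_def h_d\<Phi>)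
    also have "\<dots> \<le> \<eta> * norm v"
      using q[of t x] t True by (intro mult_right_mono) (auto simp: \<delta>_def)
    finally show ?thesis by (simp add: d\<Phi>0[OF x])
  next
    \<comment> \<open>Off \<open>K\<close> the surface does not move, so the estimate is trivial
      there; this is how a bound on all of \<open>D\<close> follows from compactness of
      \<open>K\<close>.\<close>
    case False
    have "open (D - K)" using D K by (simp add: compact_imp_closed open_Diff)
    then have "(?F has_derivative d\<Phi> t x) (at x)"
      by (rule has_derivative_transform_within_open[OF d\<Phi>[OF in_U[OF t x]]])
        (use False x outside[OF in_time[OF t]] in auto)
    then have "d\<Phi> t x = (\<lambda>v. (v, df x v))" using dF[OF x] has_derivative_unique by blast
    then show ?thesis using \<eta> by simp
  qed
  have X: "norm (fst (d\<Phi> t x v) - v) \<le> \<eta> * norm v"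
    and Y: "norm (snd (d\<Phi> t x v) - df x v) \<le> \<eta> * norm v" if "\<bar>t\<bar> < \<delta>" "x \<in> D" for t x v
  proof -
    have "norm (fst z) \<le> norm z" "norm (snd z) \<le> norm z" for z :: "(real^'n) \<times> (real^'m)"
      by (metis norm_fst_le prod.collapse) (metis norm_snd_le prod.collapse)
    from this[of "d\<Phi> t x v - (v, df x v)"] close[OF that, of v]
    show "norm (fst (d\<Phi> t x v) - v) \<le> \<eta> * norm v" "norm (snd (d\<Phi> t x v) - df x v) \<le> \<eta> * norm v"
      by simp_all
  qed
  have X_half: "norm (fst (d\<Phi> t x v) - v) \<le> norm v / 2" if "\<bar>t\<bar> < \<delta>" "x \<in> D" for t x v
    using X[OF that, of v] mult_right_mono[OF \<eta>(2) norm_ge_zero[of v]] by linarith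
  have XY: "norm (snd (d\<Phi> t x v)) \<le> norm (fst (d\<Phi> t x v))" if "\<bar>t\<bar> < \<delta>" "x \<in> D" for t x v
  proof -
    have "norm (snd (d\<Phi> t x v)) \<le> norm (df x v) + norm (snd (d\<Phi> t x v) - df x v)"
      using norm_triangle_ineq[of "df x v" "snd (d\<Phi> t x v) - df x v"] by simp
    also have "\<dots> \<le> \<beta> * norm v + \<eta> * norm v"
      using Y[OF that, of v] short[OF that(2), of v] by (simp add: df_def)
    also have "\<dots> \<le> (1 - \<eta>) * norm v"
      using mult_right_mono[OF \<eta>(3) norm_ge_zero[of v]] by (simp add: algebra_simps)
    also have "\<dots> \<le> norm v - norm (fst (d\<Phi> t x v) - v)"
      using X[OF that, of v] by (simp add: algebra_simps)
    also have "\<dots> \<le> norm (fst (d\<Phi> t x v))"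
      using norm_triangle_sub[of v "fst (d\<Phi> t x v)"] by (simp add: norm_minus_commute)
    finally show ?thesis .
  qed
  have short1: "norm (frechet_derivative f (at x) v) \<le> norm v" if "x \<in> D" for x v
    using short[OF that, of v] mult_right_mono[of \<beta> 1 "norm v"] \<open>\<beta> < 1\<close> by simp

  have volume_0: "volume K (\<Phi> 0) = volume K ?F"
  proof -
    have "partial_d i (\<Phi> 0) x = partial_d i ?F x" if "x \<in> K" for i x
      using that K in_U[of 0 x] \<delta> d\<Phi>0[of x] partial_d_eq[OF d\<Phi>, of 0 x i] partial_d_eq[OF dF, of x i]
      by auto
    then show ?thesis
      unfolding volume_def by (intro integral_cong) (simp add: induced_metric_def)
  qed
  have volume_min: "volume K (\<Phi> 0) \<le> volume K (\<Phi> t)" if t: "\<bar>t\<bar> < \<delta>" for t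
    unfolding volume_0
  proof (rule volume_graph_le[OF D K f_Ck min])
    show "Ck_on 1 D (\<Phi> t)" by (rule \<Phi>1[OF in_time[OF t]])
    fix x v assume x: "x \<in> D"
    note D\<Phi> = frechet_\<Phi>[OF in_U[OF t x]]
    show "norm (fst (frechet_derivative (\<Phi> t) (at x) v) - v) \<le> norm v / 2"
      unfolding D\<Phi> by (rule X_half[OF t x])
    show "norm (snd (frechet_derivative (\<Phi> t) (at x) v)) \<le> norm (fst (frechet_derivative (\<Phi> t) (at x) v))"
      unfolding D\<Phi> by (rule XY[OF t x])
  qed (use short1 outside[OF in_time[OF t]] in auto)

  define S where "S = {-\<delta><..<\<delta>} \<times> D"
  \<comment> \<open>The density is treated as one function of time and space, so that its time
    derivatives are directional derivatives along \<open>(1, 0)\<close> and joint continuity is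
    included in \<open>Ck_on\<close>.\<close>
  define w where "w z = sqrt (det (\<chi> i j. h i z \<bullet> h j z))" for z
  define w1 where "w1 z = frechet_derivative w (at z) (1, 0)" for z
  define w2 where "w2 z = frechet_derivative w1 (at z) (1, 0)" for z
  have S: "open S" unfolding S_def by (intro open_Times D open_greaterThanLessThan)
  have S_U: "S \<subseteq> U" using in_U by (auto simp: S_def)
  have metric: "induced_metric (\<Phi> t) x = (\<chi> i j. h i (t, x) \<bullet> h j (t, x))" if "(t, x) \<in> S" for t x
    using partial_d_eq[OF d\<Phi>] that S_U by (simp add: induced_metric_def h_d\<Phi> subset_iff)
  have w: "Ck_on 2 S w"
    unfolding w_def[abs_def]
  proof (intro Ck_on_sqrt Ck_on_det S)
    show "Ck_on 2 S (\<lambda>z. (\<chi> i j. h i z \<bullet> h j z) $ i $ j)" for i j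
      by simp (intro Ck_on_inner S Ck_on_subset[OF h S_U])
    fix z assume z: "z \<in> S"
    obtain t x where tx: "z = (t, x)" "\<bar>t\<bar> < \<delta>" "x \<in> D" using z by (auto simp: S_def)
    have "det (induced_metric (\<Phi> t) x) > 0"
      by (rule det_induced_metric_pos[OF d\<Phi>[OF in_U] X_half]) (use tx in auto)
    then show "det (\<chi> i j. h i z \<bullet> h j z) > 0" using metric z tx by simp
  qed
  have w': "Ck_on (Suc (Suc 0)) S w" using w by (simp add: numeral_2_eq_2)
  have w1: "Ck_on (Suc 0) S w1" unfolding w1_def[abs_def] by (rule Ck_on_SucD[OF w'])
  have w2: "continuous_on S w2" unfolding w2_def[abs_def] using Ck_on_SucD[OF w1] by simp
  have SK: "{-\<delta><..<\<delta>} \<times> K \<subseteq> S" using K by (auto simp: S_def)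
  have slice: "continuous_on K (\<lambda>x. u (s, x))" if "continuous_on S u" "s \<in> {-\<delta><..<\<delta>}"
    for u :: "real \<times> (real^'n) \<Rightarrow> real" and s
    by (rule continuous_on_compose2[OF that(1)]) (use SK that(2) in \<open>auto intro!: continuous_intros\<close>)
  have leibniz: "((\<lambda>s. integral K (\<lambda>x. u (s, x))) has_real_derivative
      integral K (\<lambda>x. frechet_derivative u (at (t, x)) (1, 0))) (at t)"
    if u: "Ck_on (Suc 0) S u" and t: "t \<in> {-\<delta><..<\<delta>}" for u :: "real \<times> (real^'n) \<Rightarrow> real" and t
  proof (rule DERIV_integral_compact[OF K(1) open_greaterThanLessThan t])
    show "((\<lambda>s. u (s, x)) has_real_derivative frechet_derivative u (at (s, x)) (1, 0)) (at s)"
      if "s \<in> {-\<delta><..<\<delta>}" "x \<in> K" for s x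
    proof (rule DERIV_time_slice)
      have "(s, x) \<in> S" using SK that by auto
      then show "u differentiable (at (s, x))" using u by simp
    qed
    show "continuous_on K (\<lambda>x. u (s, x))" if "s \<in> {-\<delta><..<\<delta>}" for s
      by (rule slice[OF Ck_on_imp_continuous_on[OF u] that])
    have "continuous_on S (\<lambda>z. frechet_derivative u (at z) (1, 0))"
      using Ck_on_SucD[OF u] by simp
    then show "continuous_on ({-\<delta><..<\<delta>} \<times> K) (\<lambda>(s, x). frechet_derivative u (at (s, x)) (1, 0))"
      using continuous_on_subset[OF _ SK] by (simp add: case_prod_beta')
  qed
  have vol: "volume K (\<Phi> t) = integral K (\<lambda>x. w (t, x))" if "t \<in> {-\<delta><..<\<delta>}" for t
  proof -
    have "sqrt (det (induced_metric (\<Phi> t) x)) = w (t, x)" if "x \<in> K" for x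
    proof -
      have "(t, x) \<in> S" using SK that \<open>t \<in> {-\<delta><..<\<delta>}\<close> by blast
      then show ?thesis by (simp only: w_def metric)
    qed
    then show ?thesis unfolding volume_def by (rule integral_cong)
  qed
  show ?thesis
  proof (rule second_derivative_at_local_min[OF \<delta>])
    show "((\<lambda>t. volume K (\<Phi> t)) has_real_derivative integral K (\<lambda>x. w1 (t, x))) (at t)"
      if "\<bar>t\<bar> < \<delta>" for t
    proof -
      have t: "t \<in> {-\<delta><..<\<delta>}" using that by auto
      show ?thesis
        unfolding w1_def
        by (rule has_field_derivative_transform_within_open
            [OF leibniz[OF Ck_on_Suc_imp[OF w'] t] open_greaterThanLessThan t vol[symmetric]])
    qed
    show "((\<lambda>t. integral K (\<lambda>x. w1 (t, x))) has_real_derivative integral K (\<lambda>x. w2 (0, x))) (at 0)"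
      unfolding w2_def by (rule leibniz[OF w1]) (use \<delta> in simp)
  qed (rule volume_min)
qed

theorem theoremA:
  fixes f :: "real^'n \<Rightarrow> real^'m"
    and D :: "(real^'n) set"
    and c :: real
  assumes "open D" and "connected D" and "D \<noteq> {}"
    and "smooth_on D f"
    and "c = (if CARD('m) \<le> 2 \<or> CARD('n) \<le> 2 then 1
              else real (min (CARD('m) - 1) (CARD('n) - 1)))"
    and "minimal_on D (graph_param f)"
    and "\<forall>x\<in>D. onorm (frechet_derivative f (at x)) \<le> (sqrt (1 + c) - 1) / sqrt c"
  shows "stable_on D (graph_param f)"
proof -
  define \<beta> where "\<beta> = (sqrt (1 + c) - 1) / sqrt c"
  \<comment> \<open>In the last case both dimensions are at least 3, so the minimum is at least
    2.\<close>
  have "c \<ge> 1" using assms(5) by (auto split: if_splits)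
  \<comment> \<open>Squaring: \<open>(1 + sqrt c)^2\<close> exceeds \<open>1 + c\<close> by
    \<open>2 * sqrt c\<close>. The strict inequality gives \<beta> < 1 independently of the
    point.\<close>
  have "sqrt (1 + c) < 1 + sqrt c"
    using \<open>c \<ge> 1\<close> by (intro real_less_lsqrt) (auto simp: power2_eq_square algebra_simps)
  then have "\<beta> < 1" using \<open>c \<ge> 1\<close> by (simp add: \<beta>_def divide_less_eq)
  moreover have "norm (frechet_derivative f (at x) v) \<le> \<beta> * norm v" if "x \<in> D" for x v
  proof -
    have "f differentiable (at x)"
      using assms(4) that Ck_on.simps(2)[of 0 D f] unfolding smooth_on_def by blast
    then have "bounded_linear (frechet_derivative f (at x))"
      using frechet_derivative_works has_derivative_bounded_linear by blast
    then have "norm (frechet_derivative f (at x) v) \<le> onorm (frechet_derivative f (at x)) * norm v"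
      by (rule onorm)
    also have "\<dots> \<le> \<beta> * norm v"
      using assms(7) that by (intro mult_right_mono) (auto simp: \<beta>_def)
    finally show ?thesis .
  qed
  ultimately show ?thesis
    unfolding stable_on_def
    using second_derivative_volume_nonneg[OF assms(1,4,6)] by blast
qed

end
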